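(* Let $(f,g)$ be an admissible pair on $\Omega$ with associated holomorphic function $A$ and constants $k,c_0$ (as defined in the context), and suppose $k<0$. Then $c_0\neq0$, and there are $c_1\in\mathbb{C}$, $C_2,C_3\in\mathbb{R}$ such that, writing $z=x+iy$ and $$W(z)=\frac{1}{\sqrt2}\sqrt{1+\cosh\Big(\ln\Big[\tanh\big(\tfrac{\sqrt{c_0}(z+c_1)}{2}\big)\coth\big(\tfrac{\overline{\sqrt{c_0}}(\bar z+\bar c_1)}{2}\big)\Big]\Big)},$$ one of the following three cases holds. (1) (Great Wall) $f=\pm\frac{1}{\sqrt{|c_0|}}\operatorname{sech}^{-1}[W(z)]-C_2$, with first characteristic function $h(s)=\sqrt{|c_0|}\tanh[\sqrt{|c_0|}(s+C_2)]$, and for some $\Gamma\in(0,1)$ either $g(s)=\frac{\pm\Gamma}{\sqrt{|c_0|}}\operatorname{cn}^{-1}\big[\operatorname{sech}[\sqrt{|c_0|}(s+C_2)],\Gamma\big]+C_3$ or $g(s)=\frac{\pm1}{\sqrt{|c_0|}}\operatorname{dn}^{-1}\big[\operatorname{sech}[\sqrt{|c_0|}(s+C_2)],\Gamma\big]+C_3$. (2) (Thick Wall) For some $\gamma\in(0,1)$, $f=\pm\frac{1}{\sqrt{|c_0|}}\operatorname{dn}^{-1}[W(z),\gamma]-C_2$, with $h(s)=\sqrt{|c_0|}\operatorname{sc}[\sqrt{|c_0|}(s+C_2),\gamma]\operatorname{dn}[\sqrt{|c_0|}(s+C_2),\gamma]$, and, with $P(s)=\operatorname{dn}[\sqrt{|c_0|}(s+C_2),\gamma]$,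 $g$ is one of $\frac{\pm1}{\sqrt{|c_0|}}\operatorname{sech}^{-1}[P(s)]+C_3$, $\ \frac{\pm\Gamma}{\sqrt{|c_0|}}\operatorname{cn}^{-1}[P(s),\Gamma]+C_3$, $\ \frac{\pm1}{\sqrt{|c_0|}}\operatorname{dn}^{-1}[P(s),\Gamma]+C_3$, for some $\Gamma\in(0,1)$. (3) (Sharp Wall) For some $\gamma\in(0,1)$, $f=\pm\frac{\gamma}{\sqrt{|c_0|}}\operatorname{cn}^{-1}[W(z),\gamma]-C_2$, with $h(s)=\gamma\sqrt{|c_0|}\operatorname{sd}[\tfrac{\sqrt{|c_0|}}{\gamma}(s+C_2),\gamma]\operatorname{cn}[\tfrac{\sqrt{|c_0|}}{\gamma}(s+C_2),\gamma]$, and, with $P(s)=\operatorname{cn}[\tfrac{\sqrt{|c_0|}}{\gamma}(s+C_2),\gamma]$, $g$ is one of $\frac{\pm1}{\sqrt{|c_0|}}\operatorname{sech}^{-1}[P(s)]+C_3$, $\ \frac{\pm\Gamma}{\sqrt{|c_0|}}\operatorname{cn}^{-1}[P(s),\Gamma]+C_3$, $\ \frac{\pm1}{\sqrt{|c_0|}}\operatorname{dn}^{-1}[P(s),\Gamma]+C_3$, for some $\Gamma\in(0,1)$. (The formulas for $f$ hold on $\Omega$, those for $g$ and $h$ on $f(\Omega)$.) In every case the transformed minimal graph surface $g\circ f$ is, correspondingly, $\pm\frac{1}{\sqrt{|c_0|}}\operatorname{sech}^{-1}[W(z)]+C_3$, or $\pm\frac{\Gamma}{\sqrt{|c_0|}}\operatorname{cn}^{-1}[W(z),\Gamma]+C_3$,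 or $\pm\frac{1}{\sqrt{|c_0|}}\operatorname{dn}^{-1}[W(z),\Gamma]+C_3$, according to whether $g$ is the formula with $\operatorname{sech}^{-1}$, $\operatorname{cn}^{-1}$ or $\operatorname{dn}^{-1}$; thus it is again a Great Wall, Sharp Wall or Thick Wall surface, respectively.
   Context: A minimal graph surface is a smooth $f:\Omega\to\mathbb{R}$ on an open connected $\Omega\subseteq\mathbb{R}^2\cong\mathbb{C}$ satisfying $(1+f_y^2)f_{xx}-2f_{xy}f_xf_y+(1+f_x^2)f_{yy}=0$. A smooth map $g:U\to\mathbb{R}$ ($U\subseteq\mathbb{R}$ open) is a minimal graph transformation of $f$ if $f(\Omega)\subseteq U$ and $g\circ f$ is a minimal graph surface. Admissible pair: $\Omega$ is simply connected, $f:\Omega\to\mathbb{R}$ is a minimal graph surface with $\|\nabla f\|^2$ nowhere zero, $g:U\to\mathbb{R}$ is a minimal graph transformation of $f$ with $g'^3-g'$ nowhere zero on $U$, and the first characteristic function $h=\frac{g''}{g'^3-g'}$ (which satisfies $\Delta f/\|\nabla f\|^2=h(f)$) is nowhere zero on $I=f(\Omega)$. Associated $A$, $k$, $c_0$: let $H_1$ be an antiderivative of $h$ on $I$ and $H$ an antiderivative of $e^{-H_1}$. Then $u=H\circ f$ is harmonic with $u_z\neq0$; write $u=A+\overline{A}$ with $A$ holomorphic on $\Omega$. The function $A$ satisfies $[\ln A'(z)]_{zz}=k\,[A'(z)]^2$, i.e. $A'''A'-(A'')^2=k(A')^4$, for a real constant $k$. Consequently $c_0:=\big(\tfrac{A''}{A'}\big)^2-k(A')^2$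 is a complex constant. (For $k\neq0$, with $\mathcal{B}=\ln(\sqrt{|k|}A')$, this says $\mathcal{B}_z^2=\operatorname{sgn}(k)e^{2\mathcal{B}}+c_0$.) The sign of $k$ and the value of $c_0$ do not depend on the choice of integration constants. $\sqrt{c_0}$ is a fixed complex square root. In $W$, the argument $X$ of the logarithm has modulus 1, and $\cosh(\ln X)$ means $\tfrac12(X+X^{-1})=\Re X$. Jacobi elliptic functions with modulus $\kappa\in(0,1)$: if $w=\int_0^\phi\frac{d\theta}{\sqrt{1-\kappa^2\sin^2\theta}}$ then $\operatorname{sn}(w,\kappa)=\sin\phi$, $\operatorname{cn}(w,\kappa)=\cos\phi$, $\operatorname{dn}(w,\kappa)=\sqrt{1-\kappa^2\sin^2\phi}$; $\operatorname{sc}=\operatorname{sn}/\operatorname{cn}$, $\operatorname{sd}=\operatorname{sn}/\operatorname{dn}$. With $\kappa'=\sqrt{1-\kappa^2}$: $\operatorname{cn}^{-1}(x,\kappa)=\int_x^1\frac{dt}{\sqrt{(1-t^2)(\kappa'^2+\kappa^2t^2)}}$ for $x\in[-1,1]$ and $\operatorname{dn}^{-1}(x,\kappa)=\int_x^1\frac{dt}{\sqrt{(1-t^2)(t^2-\kappa'^2)}}$ for $x\in[\kappa',1]$. $\operatorname{sech}^{-1}:(0,1]\to[0,\infty)$ is the principal inverse. *)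

theory Defs
  imports "HOL-Analysis.Analysis"
begin

section \<open>Smooth functions and minimal graph surfaces\<close>

text \<open>The plane is identified with \<^typ>\<open>complex\<close>, with coordinates \<open>z = x + i y\<close>.\<close>

definition partial_x :: "(complex \<Rightarrow> real) \<Rightarrow> complex \<Rightarrow> real" where
  "partial_x f z = deriv (\<lambda>t. f (z + of_real t)) 0"

definition partial_y :: "(complex \<Rightarrow> real) \<Rightarrow> complex \<Rightarrow> real" where
  "partial_y f z = deriv (\<lambda>t. f (z + \<i> * of_real t)) 0"

fun times_differentiable_on :: "nat \<Rightarrow> complex set \<Rightarrow> (complex \<Rightarrow> real) \<Rightarrow> bool" where
  "times_differentiable_on 0 \<Omega> f \<longleftrightarrow> continuous_on \<Omega> f"
| "times_differentiable_on (Suc n) \<Omega> f \<longleftrightarrow>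
     f differentiable_on \<Omega> \<and>
     times_differentiable_on n \<Omega> (partial_x f) \<and> times_differentiable_on n \<Omega> (partial_y f)"

text \<open>The next two notions are meant for open sets only.\<close>

definition smooth_plane :: "complex set \<Rightarrow> (complex \<Rightarrow> real) \<Rightarrow> bool" where
  "smooth_plane \<Omega> f \<longleftrightarrow> (\<forall>n. times_differentiable_on n \<Omega> f)"

definition smooth_line :: "real set \<Rightarrow> (real \<Rightarrow> real) \<Rightarrow> bool" where
  "smooth_line U g \<longleftrightarrow> (\<forall>n. (deriv ^^ n) g differentiable_on U)"

definition minimal_graph :: "complex set \<Rightarrow> (complex \<Rightarrow> real) \<Rightarrow> bool" where
  "minimal_graph \<Omega> f \<longleftrightarrow>
     open \<Omega> \<and> connected \<Omega> \<and> \<Omega> \<noteq> {} \<and> smooth_plane \<Omega> f \<and>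
     (\<forall>z\<in>\<Omega>. (1 + (partial_y f z)\<^sup>2) * partial_x (partial_x f) z
            - 2 * partial_y (partial_x f) z * partial_x f z * partial_y f z
            + (1 + (partial_x f z)\<^sup>2) * partial_y (partial_y f) z = 0)"

definition minimal_graph_transformation ::
    "complex set \<Rightarrow> (complex \<Rightarrow> real) \<Rightarrow> real set \<Rightarrow> (real \<Rightarrow> real) \<Rightarrow> bool" where
  "minimal_graph_transformation \<Omega> f U g \<longleftrightarrow>
     open U \<and> smooth_line U g \<and> f ` \<Omega> \<subseteq> U \<and> minimal_graph \<Omega> (g \<circ> f)"

definition first_char :: "(real \<Rightarrow> real) \<Rightarrow> real \<Rightarrow> real" where
  "first_char g s = deriv (deriv g) s / ((deriv g s) ^ 3 - deriv g s)"

definition admissible_pair ::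
    "complex set \<Rightarrow> (complex \<Rightarrow> real) \<Rightarrow> real set \<Rightarrow> (real \<Rightarrow> real) \<Rightarrow> bool" where
  "admissible_pair \<Omega> f U g \<longleftrightarrow>
     simply_connected \<Omega> \<and> minimal_graph \<Omega> f \<and>
     (\<forall>z\<in>\<Omega>. (partial_x f z)\<^sup>2 + (partial_y f z)\<^sup>2 \<noteq> 0) \<and>
     minimal_graph_transformation \<Omega> f U g \<and>
     (\<forall>s\<in>U. (deriv g s) ^ 3 - deriv g s \<noteq> 0) \<and>
     (\<forall>s\<in>f ` \<Omega>. first_char g s \<noteq> 0)"

text \<open>
  \<open>A\<close> depends on the choice of the antiderivatives \<open>H1\<close>, \<open>H\<close> and of an imaginary constant; the
  predicate holds for every possible choice.
\<close>

definition associated_function ::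
    "complex set \<Rightarrow> (complex \<Rightarrow> real) \<Rightarrow> (real \<Rightarrow> real) \<Rightarrow> (complex \<Rightarrow> complex) \<Rightarrow> bool" where
  "associated_function \<Omega> f g A \<longleftrightarrow>
     A holomorphic_on \<Omega> \<and>
     (\<exists>H1 H. (\<forall>s\<in>f ` \<Omega>. (H1 has_real_derivative first_char g s) (at s within f ` \<Omega>)) \<and>
             (\<forall>s\<in>f ` \<Omega>. (H has_real_derivative exp (- H1 s)) (at s within f ` \<Omega>)) \<and>
             (\<forall>z\<in>\<Omega>. complex_of_real (H (f z)) = A z + cnj (A z)))"

definition associated_constants ::
    "complex set \<Rightarrow> (complex \<Rightarrow> complex) \<Rightarrow> real \<Rightarrow> complex \<Rightarrow> bool" where
  "associated_constants \<Omega> A k c0 \<longleftrightarrow>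
     (\<forall>z\<in>\<Omega>. deriv (deriv (deriv A)) z * deriv A z - (deriv (deriv A) z)\<^sup>2
              = of_real k * (deriv A z) ^ 4) \<and>
     (\<forall>z\<in>\<Omega>. c0 = (deriv (deriv A) z / deriv A z)\<^sup>2 - of_real k * (deriv A z)\<^sup>2)"


section \<open>Hyperbolic and elliptic functions\<close>

definition coth :: "complex \<Rightarrow> complex" where
  "coth w = cosh w / sinh w"

definition sech :: "real \<Rightarrow> real" where
  "sech s = 1 / cosh s"

definition arsech :: "real \<Rightarrow> real" where
  "arsech = the_inv_into {0..} sech"

definition elliptic_F :: "real \<Rightarrow> real \<Rightarrow> real" where
  "elliptic_F \<phi> \<kappa> = (LBINT \<theta>=0..\<phi>. 1 / sqrt (1 - \<kappa>\<^sup>2 * (sin \<theta>)\<^sup>2))"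

definition jacobi_am :: "real \<Rightarrow> real \<Rightarrow> real" where
  "jacobi_am w \<kappa> = (THE \<phi>. w = elliptic_F \<phi> \<kappa>)"

definition jacobi_sn :: "real \<Rightarrow> real \<Rightarrow> real" where
  "jacobi_sn w \<kappa> = sin (jacobi_am w \<kappa>)"

definition jacobi_cn :: "real \<Rightarrow> real \<Rightarrow> real" where
  "jacobi_cn w \<kappa> = cos (jacobi_am w \<kappa>)"

definition jacobi_dn :: "real \<Rightarrow> real \<Rightarrow> real" where
  "jacobi_dn w \<kappa> = sqrt (1 - \<kappa>\<^sup>2 * (sin (jacobi_am w \<kappa>))\<^sup>2)"

definition jacobi_sc :: "real \<Rightarrow> real \<Rightarrow> real" where
  "jacobi_sc w \<kappa> = jacobi_sn w \<kappa> / jacobi_cn w \<kappa>"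

definition jacobi_sd :: "real \<Rightarrow> real \<Rightarrow> real" where
  "jacobi_sd w \<kappa> = jacobi_sn w \<kappa> / jacobi_dn w \<kappa>"

definition comodulus :: "real \<Rightarrow> real" where
  "comodulus \<kappa> = sqrt (1 - \<kappa>\<^sup>2)"

definition arccn :: "real \<Rightarrow> real \<Rightarrow> real" where
  "arccn x \<kappa> = integral {x..1} (\<lambda>t. 1 / sqrt ((1 - t\<^sup>2) * ((comodulus \<kappa>)\<^sup>2 + \<kappa>\<^sup>2 * t\<^sup>2)))"

definition arcdn :: "real \<Rightarrow> real \<Rightarrow> real" where
  "arcdn x \<kappa> = integral {x..1} (\<lambda>t. 1 / sqrt ((1 - t\<^sup>2) * (t\<^sup>2 - (comodulus \<kappa>)\<^sup>2)))"


section \<open>Walls\<close>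

text \<open>Here \<open>r\<close> plays the role of the chosen square root of \<open>c\<^sub>0\<close>.\<close>

definition wall_arg :: "complex \<Rightarrow> complex \<Rightarrow> complex \<Rightarrow> complex" where
  "wall_arg r c1 z = tanh (r * (z + c1) / 2) * coth (cnj r * (cnj z + cnj c1) / 2)"

text \<open>
  For \<open>X\<close> of modulus 1 the number \<open>cosh (Ln X)\<close> is real (whatever the branch of the logarithm), so
  taking \<^const>\<open>Re\<close> only changes the type.
\<close>

definition wall :: "complex \<Rightarrow> complex \<Rightarrow> complex \<Rightarrow> real" where
  "wall r c1 z = 1 / sqrt 2 * sqrt (1 + Re (cosh (Ln (wall_arg r c1 z))))"

text \<open>
  The three shapes \<open>\<plusminus> 1/a sech\<inverse>[w] + C\<close>, \<open>\<plusminus> \<kappa>/a cn\<inverse>[w,\<kappa>] + C\<close>, \<open>\<plusminus> 1/a dn\<inverse>[w,\<kappa>] + C\<close> of a function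
  \<open>F\<close> on a set \<open>S\<close>, with \<open>\<sigma>\<close> the sign. They include the requirement that the inner function \<open>w\<close>
  takes its values in the domain of the inverse function. For \<open>S\<close> in the plane and
  \<open>w = wall r c1\<close>, these are the Great Wall, Sharp Wall and Thick Wall surfaces; for \<open>S\<close> in the
  line they are the shapes of the transformations.
\<close>

definition sech_form :: "'p set \<Rightarrow> ('p \<Rightarrow> real) \<Rightarrow> real \<Rightarrow> real \<Rightarrow> real \<Rightarrow> ('p \<Rightarrow> real) \<Rightarrow> bool" where
  "sech_form S w a \<sigma> C F \<longleftrightarrow>
     (\<forall>p\<in>S. w p \<in> {0<..1} \<and> F p = \<sigma> / a * arsech (w p) + C)"

definition cn_form :: "'p set \<Rightarrow> ('p \<Rightarrow> real) \<Rightarrow> real \<Rightarrow> real \<Rightarrow> real \<Rightarrow> real \<Rightarrow> ('p \<Rightarrow> real) \<Rightarrow> bool" where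
  "cn_form S w a \<kappa> \<sigma> C F \<longleftrightarrow>
     (\<forall>p\<in>S. w p \<in> {-1..1} \<and> F p = \<sigma> * \<kappa> / a * arccn (w p) \<kappa> + C)"

definition dn_form :: "'p set \<Rightarrow> ('p \<Rightarrow> real) \<Rightarrow> real \<Rightarrow> real \<Rightarrow> real \<Rightarrow> real \<Rightarrow> ('p \<Rightarrow> real) \<Rightarrow> bool" where
  "dn_form S w a \<kappa> \<sigma> C F \<longleftrightarrow>
     (\<forall>p\<in>S. w p \<in> {comodulus \<kappa>..1} \<and> F p = \<sigma> / a * arcdn (w p) \<kappa> + C)"

definition great_wall where
  "great_wall \<Omega> r c1 a \<sigma> C F \<longleftrightarrow> sech_form \<Omega> (wall r c1) a \<sigma> C F"

definition sharp_wall where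
  "sharp_wall \<Omega> r c1 a \<kappa> \<sigma> C F \<longleftrightarrow> cn_form \<Omega> (wall r c1) a \<kappa> \<sigma> C F"

definition thick_wall where
  "thick_wall \<Omega> r c1 a \<kappa> \<sigma> C F \<longleftrightarrow> dn_form \<Omega> (wall r c1) a \<kappa> \<sigma> C F"

end

theory Submission
  imports Defs "HOL-Complex_Analysis.Cauchy_Integral_Formula"
begin

text \<open>
  With \<open>\<beta> = A''/A'\<close> the hypotheses on \<open>A\<close> say \<open>\<beta>' = \<beta>\<^sup>2 - r\<^sup>2 = k A'\<^sup>2\<close>, a Riccati equation solved by
  \<open>\<beta> = - r coth w\<close>, \<open>w = r (z + c1)\<close>; since \<open>k < 0\<close>, \<open>A\<close> is an imaginary multiple of \<open>ln T\<close> with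
  \<open>T = tanh (w / 2)\<close>. The minimal graph equation of \<open>f\<close> reads
  \<open>h(f) exp (- H1(f)) = 2 Re (A''/A'\<^sup>2) |A'|\<^sup>2\<close>, and the right-hand side is a multiple of \<open>Re T * Im T / |T|\<^sup>2\<close>.
  As \<open>h\<close> has no zeros, \<open>T\<close> stays in one open quadrant, \<open>W = |Re T| / |T| = cos \<theta>\<close> with \<open>\<theta>\<close> in
  \<open>(0, \<pi>/2)\<close>, and \<open>\<theta>\<close> is an affine function of \<open>H(f)\<close>, hence \<open>\<theta> = \<phi>(f)\<close>. This \<open>\<phi>\<close> solves the pendulum
  equation \<open>\<phi>'' = - a\<^sup>2 sin \<phi> cos \<phi>\<close>, so \<open>\<phi>'\<^sup>2 = E - a\<^sup>2 sin\<^sup>2 \<phi>\<close>. Moreover \<open>(1 - 1/g'\<^sup>2) \<phi>'\<^sup>2\<close> is a nonzero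
  constant, so as a function of \<open>g(s)\<close> the same angle moves on the same pendulum with another
  energy \<open>E'\<close>. Energies equal to, above and below \<open>a\<^sup>2\<close> give \<open>sech\<close>, \<open>cn\<close> and \<open>dn\<close> respectively.
\<close>

section \<open>Elliptic integrals and the inverse functions\<close>

lemma elliptic_integrand_pos:
  fixes \<kappa> \<theta> :: real
  assumes "\<kappa> \<in> {0<..<1}"
  shows "1 - \<kappa>\<^sup>2 * (sin \<theta>)\<^sup>2 > 0"
proof -
  have "\<kappa>\<^sup>2 < 1"
    using assms by (simp add: power_less_one_iff)
  moreover have "\<kappa>\<^sup>2 * (sin \<theta>)\<^sup>2 \<le> \<kappa>\<^sup>2 * 1"
    by (intro mult_left_mono) (auto simp: abs_square_le_1)
  ultimately show ?thesis by linarith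
qed

lemma elliptic_F_has_real_derivative:
  assumes \<kappa>: "\<kappa> \<in> {0<..<1}"
  shows "((\<lambda>\<phi>. elliptic_F \<phi> \<kappa>) has_real_derivative 1 / sqrt (1 - \<kappa>\<^sup>2 * (sin \<phi>)\<^sup>2)) (at \<phi>)"
proof -
  define w where "w \<theta> = 1 / sqrt (1 - \<kappa>\<^sup>2 * (sin \<theta>)\<^sup>2)" for \<theta>
  have nz: "1 - \<kappa>\<^sup>2 * (sin \<theta>)\<^sup>2 \<noteq> 0" for \<theta>
    using elliptic_integrand_pos[OF \<kappa>, of \<theta>] by simp
  have cont: "continuous_on S w" for S
    unfolding w_def by (intro continuous_intros) (use nz in auto)
  \<comment> \<open>A primitive on the whole line is used, so that one formula covers upper limits
    of either sign and the derivative is two-sided everywhere.\<close>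
  obtain \<Phi> where \<Phi>: "\<And>x. (\<Phi> has_vector_derivative w x) (at x)"
    using einterval_antiderivative[of "-\<infinity>" "\<infinity>" w] cont[of UNIV]
    by (auto simp: continuous_on_eq_continuous_within)
  have "elliptic_F \<phi> \<kappa> = \<Phi> \<phi> - \<Phi> 0" for \<phi>
    unfolding elliptic_F_def w_def[symmetric] zero_ereal_def
    by (rule interval_integral_FTC_finite[OF cont]) (use \<Phi> in \<open>auto intro: has_vector_derivative_at_within\<close>)
  then show ?thesis
    using \<Phi>[of \<phi>]
    by (auto simp: w_def has_real_derivative_iff_has_vector_derivative intro!: derivative_eq_intros)
qed

lemma continuous_on_elliptic_F:
  assumes \<kappa>: "\<kappa> \<in> {0<..<1}" and "continuous_on S f"
  shows "continuous_on S (\<lambda>x. elliptic_F (f x) \<kappa>)"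
proof (rule continuous_on_compose2[of UNIV "\<lambda>x. elliptic_F x \<kappa>", OF _ assms(2)])
  show "continuous_on UNIV (\<lambda>x. elliptic_F x \<kappa>)"
    using elliptic_F_has_real_derivative[OF \<kappa>]
    by (intro continuous_at_imp_continuous_on ballI DERIV_isCont)
qed simp

lemma elliptic_F_0 [simp]: "elliptic_F 0 \<kappa> = 0"
  by (simp add: elliptic_F_def zero_ereal_def[symmetric])

text \<open>The integrand is even. This later moves a sign in front of the integral into the
  amplitude.\<close>

lemma elliptic_F_minus:
  assumes "\<kappa> \<in> {0<..<1}"
  shows "elliptic_F (- \<phi>) \<kappa> = - elliptic_F \<phi> \<kappa>"
proof -
  have "((\<lambda>\<phi>. elliptic_F \<phi> \<kappa> + elliptic_F (- \<phi>) \<kappa>) has_real_derivative 0) (at x)" for x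
  proof -
    have "((\<lambda>\<phi>. elliptic_F (- \<phi>) \<kappa>) has_real_derivative
        1 / sqrt (1 - \<kappa>\<^sup>2 * (sin (- x))\<^sup>2) * (- 1)) (at x)"
      by (rule DERIV_chain2[OF elliptic_F_has_real_derivative[OF assms]]) (auto intro!: derivative_eq_intros)
    from DERIV_add[OF elliptic_F_has_real_derivative[OF assms] this] show ?thesis by simp
  qed
  then have "elliptic_F \<phi> \<kappa> + elliptic_F (- \<phi>) \<kappa> = elliptic_F 0 \<kappa> + elliptic_F (- 0) \<kappa>"
    using DERIV_isconst_all by blast
  then show ?thesis by simp
qed

text \<open>The positive derivative makes the integral strictly increasing; this uniqueness resolves
  the description \<open>THE\<close> in \<open>jacobi_am\<close>.\<close>

lemma inj_elliptic_F:
  assumes "\<kappa> \<in> {0<..<1}"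
  shows "inj (\<lambda>\<phi>. elliptic_F \<phi> \<kappa>)"
proof -
  have "elliptic_F x \<kappa> < elliptic_F y \<kappa>" if "x < y" for x y
    using that
    by (rule DERIV_pos_imp_increasing)
      (use elliptic_F_has_real_derivative[OF assms] elliptic_integrand_pos[OF assms] in
        \<open>force intro: real_sqrt_gt_zero\<close>)
  then show ?thesis
    by (metis injI linorder_neq_iff less_irrefl)
qed

lemma jacobi_am_elliptic_F:
  assumes "\<kappa> \<in> {0<..<1}"
  shows "jacobi_am (elliptic_F \<phi> \<kappa>) \<kappa> = \<phi>"
  unfolding jacobi_am_def using inj_elliptic_F[OF assms] by (auto dest: injD)

text \<open>Substitution \<open>t = cos \<theta>\<close>: the second factor under the root becomes
  \<open>1 - \<kappa>\<^sup>2 * (sin \<theta>)\<^sup>2\<close>. The integrand is singular at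
  \<open>t = 1\<close>, hence the form of the fundamental theorem that asks there only for
  continuity of the primitive.\<close>

lemma arccn_cos:
  assumes \<kappa>: "\<kappa> \<in> {0<..<1}" and \<phi>: "0 < \<phi>" "\<phi> < pi / 2"
  shows "arccn (cos \<phi>) \<kappa> = elliptic_F \<phi> \<kappa>"
proof -
  let ?f = "\<lambda>t. 1 / sqrt ((1 - t\<^sup>2) * ((comodulus \<kappa>)\<^sup>2 + \<kappa>\<^sup>2 * t\<^sup>2))"
  have \<kappa>2: "(comodulus \<kappa>)\<^sup>2 = 1 - \<kappa>\<^sup>2"
    using \<kappa> by (simp add: comodulus_def power_le_one)
  have c: "0 < cos \<phi>" using \<phi> by (intro cos_gt_zero) auto
  have "(?f has_integral - elliptic_F (arccos 1) \<kappa> - - elliptic_F (arccos (cos \<phi>)) \<kappa>) {cos \<phi>..1}"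
  proof (rule fundamental_theorem_of_calculus_interior)
    have "continuous_on {cos \<phi>..1} arccos"
      using c by (intro continuous_on_subset[OF continuous_on_arccos']) auto
    then show "continuous_on {cos \<phi>..1} (\<lambda>t. - elliptic_F (arccos t) \<kappa>)"
      by (intro continuous_on_minus continuous_on_elliptic_F[OF \<kappa>])
    fix t assume t: "t \<in> {cos \<phi><..<1}"
    have t2: "t\<^sup>2 < 1" using t c by (simp add: power_less_one_iff)
    have s: "(sin (arccos t))\<^sup>2 = 1 - t\<^sup>2"
      using t c t2 by (simp add: sin_arccos)
    have "((\<lambda>t. - elliptic_F (arccos t) \<kappa>) has_real_derivative
        - (1 / sqrt (1 - \<kappa>\<^sup>2 * (sin (arccos t))\<^sup>2) * inverse (- sqrt (1 - t\<^sup>2)))) (at t)"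
      using t c
      by (intro DERIV_minus DERIV_chain2[OF elliptic_F_has_real_derivative[OF \<kappa>] DERIV_arccos]) auto
    also have "- (1 / sqrt (1 - \<kappa>\<^sup>2 * (sin (arccos t))\<^sup>2) * inverse (- sqrt (1 - t\<^sup>2))) = ?f t"
    proof -
      have "1 - \<kappa>\<^sup>2 * (1 - t\<^sup>2) = 1 - \<kappa>\<^sup>2 + \<kappa>\<^sup>2 * t\<^sup>2" by algebra
      then show ?thesis unfolding s \<kappa>2 real_sqrt_mult by (simp add: divide_inverse)
    qed
    finally show "((\<lambda>t. - elliptic_F (arccos t) \<kappa>) has_vector_derivative ?f t) (at t)"
      by (simp add: has_real_derivative_iff_has_vector_derivative)
  qed auto
  then show ?thesis
    unfolding arccn_def using \<phi> by (simp add: integral_unique arccos_cos)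
qed

text \<open>An amplitude with dn equal to \<open>cos \<phi>\<close> has sine
  \<open>sin \<phi> / \<kappa>\<close>. The bound \<open>sin \<phi> < \<kappa>\<close> keeps this
  quotient below 1 and the interval of integration away from the singularity at
  \<open>comodulus \<kappa>\<close>.\<close>

lemma arcdn_cos:
  assumes \<kappa>: "\<kappa> \<in> {0<..<1}" and \<phi>: "0 < \<phi>" "\<phi> < pi / 2" and sin: "sin \<phi> < \<kappa>"
  shows "arcdn (cos \<phi>) \<kappa> = elliptic_F (arcsin (sin \<phi> / \<kappa>)) \<kappa>"
proof -
  let ?f = "\<lambda>t. 1 / sqrt ((1 - t\<^sup>2) * (t\<^sup>2 - (comodulus \<kappa>)\<^sup>2))"
  let ?F = "\<lambda>t. - elliptic_F (arcsin (sqrt (1 - t\<^sup>2) / \<kappa>)) \<kappa>"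
  have \<kappa>2: "(comodulus \<kappa>)\<^sup>2 = 1 - \<kappa>\<^sup>2"
    using \<kappa> by (simp add: comodulus_def power_le_one)
  have c: "0 < cos \<phi>" using \<phi> by (intro cos_gt_zero) auto
  have s: "0 < sin \<phi>" using \<phi> by (intro sin_gt_zero) auto
  have sq: "sqrt (1 - (cos \<phi>)\<^sup>2) = sin \<phi>"
    using s by (simp add: sin_squared_eq[symmetric])
  have le: "0 \<le> sqrt (1 - t\<^sup>2) / \<kappa>" "sqrt (1 - t\<^sup>2) / \<kappa> < 1" if "t \<in> {cos \<phi>..1}" for t
  proof -
    have "(cos \<phi>)\<^sup>2 \<le> t\<^sup>2" using that c by (intro power_mono) auto
    then have "sqrt (1 - t\<^sup>2) \<le> sin \<phi>" using sq by (metis diff_left_mono real_sqrt_le_mono)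
    then show "sqrt (1 - t\<^sup>2) / \<kappa> < 1" using sin \<kappa> by simp
    have "t\<^sup>2 \<le> 1" using that c by (simp add: power_le_one)
    then show "0 \<le> sqrt (1 - t\<^sup>2) / \<kappa>" using \<kappa> by simp
  qed
  have "(?f has_integral ?F 1 - ?F (cos \<phi>)) {cos \<phi>..1}"
  proof (rule fundamental_theorem_of_calculus_interior)
    have "- 1 \<le> sqrt (1 - t\<^sup>2) / \<kappa> \<and> sqrt (1 - t\<^sup>2) / \<kappa> \<le> 1" if "t \<in> {cos \<phi>..1}" for t
      using le[OF that] by linarith
    moreover have "continuous_on {cos \<phi>..1} (\<lambda>t. sqrt (1 - t\<^sup>2) / \<kappa>)"
      using \<kappa> by (intro continuous_intros) auto
    ultimately have "continuous_on {cos \<phi>..1} (\<lambda>t. arcsin (sqrt (1 - t\<^sup>2) / \<kappa>))"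
      by (intro continuous_on_arcsin) auto
    then show "continuous_on {cos \<phi>..1} ?F"
      by (intro continuous_on_minus continuous_on_elliptic_F[OF \<kappa>])
    fix t assume t: "t \<in> {cos \<phi><..<1}"
    have t0: "0 < t" using t c by auto
    have t2: "t\<^sup>2 < 1" using t c by (simp add: power_less_one_iff)
    \<comment> \<open>\<open>q\<close> is the sine of the amplitude at which dn takes the value
      \<open>t\<close>.\<close>
    define q where "q = sqrt (1 - t\<^sup>2) / \<kappa>"
    have q: "0 \<le> q" "q < 1" using le[of t] t by (auto simp: q_def)
    have q2: "q\<^sup>2 = (1 - t\<^sup>2) / \<kappa>\<^sup>2" using t2 by (simp add: q_def power_divide)
    have "1 - \<kappa>\<^sup>2 * (sin (arcsin q))\<^sup>2 = t\<^sup>2"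
      using q q2 \<kappa> by (simp add: field_simps)
    then have s1: "sqrt (1 - \<kappa>\<^sup>2 * (sin (arcsin q))\<^sup>2) = t" using t0 by simp
    have s2: "\<kappa> * sqrt (1 - q\<^sup>2) = sqrt (t\<^sup>2 - (comodulus \<kappa>)\<^sup>2)"
    proof -
      have "t\<^sup>2 - (comodulus \<kappa>)\<^sup>2 = \<kappa>\<^sup>2 * (1 - q\<^sup>2)"
        unfolding q2 \<kappa>2 using \<kappa> by (simp add: field_simps)
      then show ?thesis using \<kappa> by (simp add: real_sqrt_mult)
    qed
    have "q\<^sup>2 < 1" using q by (simp add: power_less_one_iff)
    then have q1: "sqrt (1 - q\<^sup>2) > 0" by simp
    have "((\<lambda>t. sqrt (1 - t\<^sup>2) / \<kappa>) has_real_derivative - t / sqrt (1 - t\<^sup>2) / \<kappa>) (at t)"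
      using t2 \<kappa> by (auto intro!: derivative_eq_intros simp: field_simps)
    moreover have "(arcsin has_real_derivative inverse (sqrt (1 - q\<^sup>2))) (at (sqrt (1 - t\<^sup>2) / \<kappa>))"
      unfolding q_def[symmetric] using q by (intro DERIV_arcsin) auto
    ultimately have "((\<lambda>t. arcsin (sqrt (1 - t\<^sup>2) / \<kappa>)) has_real_derivative
        inverse (sqrt (1 - q\<^sup>2)) * (- t / sqrt (1 - t\<^sup>2) / \<kappa>)) (at t)"
      by (rule DERIV_chain2[rotated])
    from DERIV_minus[OF DERIV_chain2[OF elliptic_F_has_real_derivative[OF \<kappa>] this]]
    have "(?F has_real_derivative
        - (1 / sqrt (1 - \<kappa>\<^sup>2 * (sin (arcsin q))\<^sup>2) *
           (inverse (sqrt (1 - q\<^sup>2)) * (- t / sqrt (1 - t\<^sup>2) / \<kappa>)))) (at t)"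
      unfolding q_def[symmetric] .
    also have "- (1 / sqrt (1 - \<kappa>\<^sup>2 * (sin (arcsin q))\<^sup>2) *
           (inverse (sqrt (1 - q\<^sup>2)) * (- t / sqrt (1 - t\<^sup>2) / \<kappa>))) = ?f t"
      unfolding s1 real_sqrt_mult s2[symmetric] using t0 t2 q1 \<kappa> by (simp add: field_simps)
    finally show "(?F has_vector_derivative ?f t) (at t)"
      by (simp add: has_real_derivative_iff_has_vector_derivative)
  qed auto
  then show ?thesis
    unfolding arcdn_def by (simp add: integral_unique sq)
qed

lemma arsech_cos:
  assumes \<phi>: "0 < \<phi>" "\<phi> < pi / 2"
  shows "arsech (cos \<phi>) = arcosh (1 / cos \<phi>)"
proof -
  have c: "0 < cos \<phi>" "cos \<phi> \<le> 1" using \<phi> by (auto intro: cos_gt_zero)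
  have "inj_on sech {0..}"
    by (auto simp: inj_on_def sech_def)
  moreover have "sech (arcosh (1 / cos \<phi>)) = cos \<phi>"
    using c by (simp add: sech_def cosh_arcosh_real)
  moreover have "arcosh (1 / cos \<phi>) \<ge> 0"
    using c by simp
  ultimately show ?thesis
    unfolding arsech_def by (metis atLeast_iff the_inv_into_f_f)
qed

text \<open>The angle is the Gudermannian of \<open>arsech (cos \<phi>)\<close>: there cosh is
  \<open>1 / cos \<phi>\<close>, so sinh is the tangent of \<open>\<phi>\<close>.\<close>

lemma sech_arsech_cos:
  assumes \<phi>: "0 < \<phi>" "\<phi> < pi / 2"
  shows "sech (arsech (cos \<phi>)) = cos \<phi>" "tanh (arsech (cos \<phi>)) = sin \<phi>"
proof -
  have c: "0 < cos \<phi>" "cos \<phi> \<le> 1" using \<phi> by (auto intro: cos_gt_zero)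
  have s: "0 < sin \<phi>" using \<phi> by (intro sin_gt_zero) auto
  show "sech (arsech (cos \<phi>)) = cos \<phi>"
    using c by (simp add: sech_def cosh_arcosh_real arsech_cos[OF \<phi>])
  have "sinh (arcosh (1 / cos \<phi>)) = sin \<phi> / cos \<phi>"
  proof -
    have "(1 / cos \<phi>)\<^sup>2 - 1 = (sin \<phi> / cos \<phi>)\<^sup>2"
      using c by (simp add: power_divide sin_squared_eq field_simps)
    then show ?thesis using c s by (simp add: sinh_arcosh_real)
  qed
  then show "tanh (arsech (cos \<phi>)) = sin \<phi>"
    using c by (simp add: tanh_def cosh_arcosh_real arsech_cos[OF \<phi>])
qed

section \<open>The pendulum equation\<close>

lemma arsech_cos_has_real_derivative:
  assumes x: "0 < x" "x < pi / 2" and a: "a > 0"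
  shows "((\<lambda>x. 1 / a * arsech (cos x)) has_real_derivative 1 / sqrt (a\<^sup>2 - a\<^sup>2 * (sin x)\<^sup>2)) (at x)"
proof -
  have c: "0 < cos x" using x by (intro cos_gt_zero) auto
  have s: "0 < sin x" using x by (intro sin_gt_zero) auto
  have "cos x < 1"
    using cos_monotone_0_pi[of 0 x] x by simp
  then have gt: "1 / cos x > 1" using c by simp
  have "(1 / cos x)\<^sup>2 - 1 = (sin x / cos x)\<^sup>2"
    using c by (simp add: power_divide sin_squared_eq field_simps)
  then have sq: "sqrt ((1 / cos x)\<^sup>2 - 1) = sin x / cos x"
    using s c by simp
  have "a\<^sup>2 - a\<^sup>2 * (sin x)\<^sup>2 = (a * cos x)\<^sup>2"
    by (simp add: cos_squared_eq algebra_simps power_mult_distrib)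
  \<comment> \<open>At energy \<open>a\<^sup>2\<close> the speed degenerates to
    \<open>a * cos x\<close>, so the travel time is elementary.\<close>
  then have sqa: "sqrt (a\<^sup>2 - a\<^sup>2 * (sin x)\<^sup>2) = a * cos x"
    using a c by simp
  have "((\<lambda>x. 1 / cos x) has_real_derivative sin x / (cos x)\<^sup>2) (at x)"
    using c by (auto intro!: derivative_eq_intros simp: power2_eq_square)
  from DERIV_chain2[OF arcosh_real_has_field_derivative[OF gt] this]
  have "((\<lambda>x. arcosh (1 / cos x)) has_real_derivative 1 / cos x) (at x)"
    unfolding sq using c s by (simp add: power2_eq_square)
  from DERIV_cmult[OF this, of "1 / a"]
  have "((\<lambda>x. 1 / a * arcosh (1 / cos x)) has_real_derivative 1 / sqrt (a\<^sup>2 - a\<^sup>2 * (sin x)\<^sup>2)) (at x)"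
    unfolding sqa by simp
  then show ?thesis
    by (rule has_field_derivative_transform_within_open[of _ _ _ "{0<..<pi/2}"])
      (use x in \<open>auto simp: arsech_cos\<close>)
qed

text \<open>Factoring the energy \<open>(a / \<kappa>)\<^sup>2\<close> out of the root leaves the
  elliptic integrand of modulus \<open>\<kappa>\<close> at the angle itself.\<close>

lemma arccn_cos_has_real_derivative:
  assumes x: "0 < x" "x < pi / 2" and a: "a > 0" and \<kappa>: "\<kappa> \<in> {0<..<1}"
  shows "((\<lambda>x. \<kappa> / a * arccn (cos x) \<kappa>) has_real_derivative
    1 / sqrt ((a / \<kappa>)\<^sup>2 - a\<^sup>2 * (sin x)\<^sup>2)) (at x)"
proof -
  have "(a / \<kappa>)\<^sup>2 - a\<^sup>2 * (sin x)\<^sup>2 = (a / \<kappa>)\<^sup>2 * (1 - \<kappa>\<^sup>2 * (sin x)\<^sup>2)"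
    using \<kappa> by (simp add: field_simps)
  then have "sqrt ((a / \<kappa>)\<^sup>2 - a\<^sup>2 * (sin x)\<^sup>2) = a / \<kappa> * sqrt (1 - \<kappa>\<^sup>2 * (sin x)\<^sup>2)"
    using a \<kappa> by (simp only: real_sqrt_mult) simp
  with DERIV_cmult[OF elliptic_F_has_real_derivative[OF \<kappa>, of x], of "\<kappa> / a"]
  have "((\<lambda>x. \<kappa> / a * elliptic_F x \<kappa>) has_real_derivative
      1 / sqrt ((a / \<kappa>)\<^sup>2 - a\<^sup>2 * (sin x)\<^sup>2)) (at x)"
    by simp
  then show ?thesis
    by (rule has_field_derivative_transform_within_open[of _ _ _ "{0<..<pi/2}"])
      (use x in \<open>auto simp: arccn_cos[OF \<kappa>]\<close>)
qed

text \<open>At energy \<open>(a * \<kappa>)\<^sup>2\<close> the amplitude is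
  \<open>arcsin (sin x / \<kappa>)\<close> instead of \<open>x\<close>. Its derivative brings in
  \<open>cos x\<close>, which cancels against the elliptic integrand.\<close>

lemma arcdn_cos_has_real_derivative:
  assumes x: "0 < x" "x < pi / 2" "sin x < \<kappa>" and a: "a > 0" and \<kappa>: "\<kappa> \<in> {0<..<1}"
  shows "((\<lambda>x. 1 / a * arcdn (cos x) \<kappa>) has_real_derivative
    1 / sqrt ((a * \<kappa>)\<^sup>2 - a\<^sup>2 * (sin x)\<^sup>2)) (at x)"
proof -
  have c: "0 < cos x" using x by (intro cos_gt_zero) auto
  have s: "0 < sin x" using x by (intro sin_gt_zero) auto
  define q where "q = sin x / \<kappa>"
  have q: "0 < q" "q < 1" using s x \<kappa> by (auto simp: q_def)
  have q1: "sqrt (1 - q\<^sup>2) > 0" using q by (simp add: power_less_one_iff)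
  have "1 - \<kappa>\<^sup>2 * (sin (arcsin q))\<^sup>2 = (cos x)\<^sup>2"
    using q \<kappa> by (simp add: q_def power_divide cos_squared_eq)
  then have s1: "sqrt (1 - \<kappa>\<^sup>2 * (sin (arcsin q))\<^sup>2) = cos x" using c by simp
  have "(a * \<kappa>)\<^sup>2 - a\<^sup>2 * (sin x)\<^sup>2 = (a * \<kappa>)\<^sup>2 * (1 - q\<^sup>2)"
    using \<kappa> by (simp add: q_def field_simps)
  then have s2: "sqrt ((a * \<kappa>)\<^sup>2 - a\<^sup>2 * (sin x)\<^sup>2) = a * \<kappa> * sqrt (1 - q\<^sup>2)"
    using a \<kappa> by (simp only: real_sqrt_mult) simp
  have "((\<lambda>x. sin x / \<kappa>) has_real_derivative cos x / \<kappa>) (at x)"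
    using \<kappa> by (auto intro!: derivative_eq_intros)
  moreover have "(arcsin has_real_derivative inverse (sqrt (1 - q\<^sup>2))) (at (sin x / \<kappa>))"
    unfolding q_def[symmetric] using q by (intro DERIV_arcsin) auto
  ultimately have "((\<lambda>x. arcsin (sin x / \<kappa>)) has_real_derivative
      inverse (sqrt (1 - q\<^sup>2)) * (cos x / \<kappa>)) (at x)"
    by (rule DERIV_chain2[rotated])
  from DERIV_cmult[OF DERIV_chain2[OF elliptic_F_has_real_derivative[OF \<kappa>] this], of "1 / a"]
  have "((\<lambda>x. 1 / a * elliptic_F (arcsin (sin x / \<kappa>)) \<kappa>) has_real_derivative
      1 / a * (1 / sqrt (1 - \<kappa>\<^sup>2 * (sin (arcsin q))\<^sup>2) * (inverse (sqrt (1 - q\<^sup>2)) * (cos x / \<kappa>)))) (at x)"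
    unfolding q_def[symmetric] .
  also have "1 / a * (1 / sqrt (1 - \<kappa>\<^sup>2 * (sin (arcsin q))\<^sup>2) * (inverse (sqrt (1 - q\<^sup>2)) * (cos x / \<kappa>)))
      = 1 / sqrt ((a * \<kappa>)\<^sup>2 - a\<^sup>2 * (sin x)\<^sup>2)"
    unfolding s1 s2 using q1 a c \<kappa> by (simp add: field_simps)
  finally show ?thesis
    by (rule has_field_derivative_transform_within_open[of _ _ _ "{0<..<pi/2} \<inter> {x. sin x < \<kappa>}"])
      (use x in \<open>auto simp: arcdn_cos[OF \<kappa>] intro!: open_Int open_Collect_less continuous_intros\<close>)
qed

text \<open>Separation of variables: as \<open>\<tau>\<close> squares to 1, the derivative of
  \<open>F s - \<tau> * G (\<phi> s)\<close> is \<open>F' s - F' s\<close>. Here \<open>F\<close>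
  plays the part of time; it will be the identity for the surface \<open>f\<close> and
  \<open>g\<close> for the transformed one.\<close>

lemma pendulum_primitive:
  fixes \<phi> F G :: "real \<Rightarrow> real"
  assumes I: "convex I" and \<tau>: "\<tau> \<in> {1, -1}"
    and pos: "\<And>s. s \<in> I \<Longrightarrow> E - a\<^sup>2 * (sin (\<phi> s))\<^sup>2 > 0"
    and d\<phi>: "\<And>s. s \<in> I \<Longrightarrow>
      (\<phi> has_real_derivative \<tau> * F' s * sqrt (E - a\<^sup>2 * (sin (\<phi> s))\<^sup>2)) (at s within I)"
    and dF: "\<And>s. s \<in> I \<Longrightarrow> (F has_real_derivative F' s) (at s within I)"
    and dG: "\<And>s. s \<in> I \<Longrightarrow>
      (G has_real_derivative 1 / sqrt (E - a\<^sup>2 * (sin (\<phi> s))\<^sup>2)) (at (\<phi> s))"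
  shows "\<exists>C. \<forall>s\<in>I. F s = \<tau> * G (\<phi> s) + C"
proof -
  have "((\<lambda>s. F s - \<tau> * G (\<phi> s)) has_real_derivative 0) (at s within I)" if s: "s \<in> I" for s
  proof -
    have "((\<lambda>s. F s - \<tau> * G (\<phi> s)) has_real_derivative
        F' s - \<tau> * (1 / sqrt (E - a\<^sup>2 * (sin (\<phi> s))\<^sup>2) *
          (\<tau> * F' s * sqrt (E - a\<^sup>2 * (sin (\<phi> s))\<^sup>2)))) (at s within I)"
      by (rule DERIV_diff[OF dF[OF s] DERIV_cmult[OF DERIV_chain2[OF dG[OF s] d\<phi>[OF s]]]])
    then show ?thesis using pos[OF s] \<tau> by auto
  qed
  from has_field_derivative_zero_constant[OF I this] show ?thesis
    by (metis diff_eq_eq add.commute)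
qed

text \<open>Energy \<open>a\<^sup>2\<close> is the separatrix, larger energies belong to a rotating
  and smaller ones to a swinging pendulum. The conclusion records \<open>E\<close> so that motions
  of different energy can be told apart later.\<close>

lemma pendulum_forms:
  fixes \<phi> F :: "real \<Rightarrow> real"
  assumes I: "convex I" "I \<noteq> {}" and a: "a > 0" and \<tau>: "\<tau> \<in> {1, -1}"
    and \<phi>: "\<And>s. s \<in> I \<Longrightarrow> 0 < \<phi> s \<and> \<phi> s < pi / 2"
    and pos: "\<And>s. s \<in> I \<Longrightarrow> E - a\<^sup>2 * (sin (\<phi> s))\<^sup>2 > 0"
    and d\<phi>: "\<And>s. s \<in> I \<Longrightarrow>
      (\<phi> has_real_derivative \<tau> * F' s * sqrt (E - a\<^sup>2 * (sin (\<phi> s))\<^sup>2)) (at s within I)"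
    and dF: "\<And>s. s \<in> I \<Longrightarrow> (F has_real_derivative F' s) (at s within I)"
  shows "\<exists>C. E = a\<^sup>2 \<and> sech_form I (\<lambda>s. cos (\<phi> s)) a \<tau> C F \<or>
    (\<exists>\<Gamma>\<in>{0<..<1}. E = (a / \<Gamma>)\<^sup>2 \<and> cn_form I (\<lambda>s. cos (\<phi> s)) a \<Gamma> \<tau> C F) \<or>
    (\<exists>\<Gamma>\<in>{0<..<1}. E = (a * \<Gamma>)\<^sup>2 \<and> dn_form I (\<lambda>s. cos (\<phi> s)) a \<Gamma> \<tau> C F)"
proof -
  note prim = pendulum_primitive[OF I(1) \<tau> pos d\<phi> dF]
  have c: "0 < cos (\<phi> s)" and s: "0 < sin (\<phi> s)" if "s \<in> I" for s
    using \<phi>[OF that] by (auto intro: cos_gt_zero sin_gt_zero)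
  have E: "E > 0"
  proof -
    obtain s where "s \<in> I" using I by auto
    then have "0 < E - a\<^sup>2 * (sin (\<phi> s))\<^sup>2" by (rule pos)
    moreover have "0 \<le> a\<^sup>2 * (sin (\<phi> s))\<^sup>2" by simp
    ultimately show ?thesis by linarith
  qed
  consider "E = a\<^sup>2" | "E > a\<^sup>2" | "E < a\<^sup>2" by linarith
  then show ?thesis
  proof cases
    case 1
    obtain C where "\<forall>s\<in>I. F s = \<tau> * (1 / a * arsech (cos (\<phi> s))) + C"
      using prim[of "\<lambda>x. 1 / a * arsech (cos x)"] arsech_cos_has_real_derivative[OF _ _ a] \<phi> 1 by blast
    then have "sech_form I (\<lambda>s. cos (\<phi> s)) a \<tau> C F"
      unfolding sech_form_def using c by auto
    then show ?thesis using 1 by blast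
  next
    case 2
    define \<Gamma> where "\<Gamma> = a / sqrt E"
    have "a < sqrt E" using 2 a by (simp add: real_less_rsqrt)
    then have \<Gamma>: "\<Gamma> \<in> {0<..<1}" using a E by (simp add: \<Gamma>_def)
    have EE: "E = (a / \<Gamma>)\<^sup>2" using a E by (simp add: \<Gamma>_def)
    obtain C where "\<forall>s\<in>I. F s = \<tau> * (\<Gamma> / a * arccn (cos (\<phi> s)) \<Gamma>) + C"
      using prim[of "\<lambda>x. \<Gamma> / a * arccn (cos x) \<Gamma>"] arccn_cos_has_real_derivative[OF _ _ a \<Gamma>] \<phi> EE by blast
    then have "cn_form I (\<lambda>s. cos (\<phi> s)) a \<Gamma> \<tau> C F"
      unfolding cn_form_def by auto
    then show ?thesis using \<Gamma> EE by blast
  next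
    case 3
    define \<Gamma> where "\<Gamma> = sqrt E / a"
    have "sqrt E < a" using 3 a by (simp add: real_less_lsqrt)
    then have \<Gamma>: "\<Gamma> \<in> {0<..<1}" using a E by (simp add: \<Gamma>_def)
    have EE: "E = (a * \<Gamma>)\<^sup>2" using a E by (simp add: \<Gamma>_def)
    \<comment> \<open>Positive kinetic energy keeps the angle below the turning point
      \<open>arcsin \<Gamma>\<close>, which is the domain condition of \<open>arcdn\<close>.\<close>
    have lt: "sin (\<phi> s) < \<Gamma>" if "s \<in> I" for s
    proof -
      have "a\<^sup>2 * (sin (\<phi> s))\<^sup>2 < a\<^sup>2 * \<Gamma>\<^sup>2"
        using pos[OF that] unfolding EE by (simp add: power_mult_distrib)
      then have "(sin (\<phi> s))\<^sup>2 < \<Gamma>\<^sup>2" using a by simp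
      then show ?thesis using \<Gamma> by (simp add: power_less_imp_less_base)
    qed
    obtain C where C: "\<forall>s\<in>I. F s = \<tau> * (1 / a * arcdn (cos (\<phi> s)) \<Gamma>) + C"
      using prim[of "\<lambda>x. 1 / a * arcdn (cos x) \<Gamma>"] arcdn_cos_has_real_derivative[OF _ _ _ a \<Gamma>] \<phi> lt EE by blast
    have "comodulus \<Gamma> \<le> cos (\<phi> s)" if "s \<in> I" for s
    proof -
      have "(sin (\<phi> s))\<^sup>2 \<le> \<Gamma>\<^sup>2" using lt[OF that] s[OF that] by (intro power_mono) auto
      then have "sqrt (1 - \<Gamma>\<^sup>2) \<le> sqrt ((cos (\<phi> s))\<^sup>2)"
        by (simp only: cos_squared_eq real_sqrt_le_iff)
      then show ?thesis using c[OF that] by (simp add: comodulus_def)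
    qed
    with C have "dn_form I (\<lambda>s. cos (\<phi> s)) a \<Gamma> \<tau> C F"
      unfolding dn_form_def by auto
    then show ?thesis using \<Gamma> EE by blast
  qed
qed

section \<open>Solving the travel-time laws for \<open>cos \<phi>\<close> and for
  \<open>h\<close>\<close>

lemma pendulum_sech:
  assumes \<phi>: "0 < \<phi>" "\<phi> < pi / 2" and a: "a > 0" and \<sigma>: "\<sigma> \<in> {1, -1::real}"
    and s: "s = \<sigma> / a * arsech (cos \<phi>) - C"
    and h: "h * (\<sigma> * sqrt (a\<^sup>2 - a\<^sup>2 * (sin \<phi>)\<^sup>2)) = a\<^sup>2 * sin \<phi> * cos \<phi>"
  shows "sech (a * (s + C)) = cos \<phi>" "h = a * tanh (a * (s + C))"
proof -
  have c: "0 < cos \<phi>" using \<phi> by (intro cos_gt_zero) auto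
  have w: "a * (s + C) = \<sigma> * arsech (cos \<phi>)" using a by (simp add: s)
  show "sech (a * (s + C)) = cos \<phi>"
    unfolding w using \<sigma> sech_arsech_cos(1)[OF \<phi>] by (auto simp: sech_def)
  have t: "tanh (a * (s + C)) = \<sigma> * sin \<phi>"
    unfolding w using \<sigma> sech_arsech_cos(2)[OF \<phi>] by auto
  have "a\<^sup>2 - a\<^sup>2 * (sin \<phi>)\<^sup>2 = (a * cos \<phi>)\<^sup>2"
    by (simp add: cos_squared_eq algebra_simps power_mult_distrib)
  then have "sqrt (a\<^sup>2 - a\<^sup>2 * (sin \<phi>)\<^sup>2) = a * cos \<phi>"
    using a c by simp
  with h have "h * \<sigma> * (a * cos \<phi>) = a * sin \<phi> * (a * cos \<phi>)"
    by (simp add: power2_eq_square mult_ac)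
  then have "h * \<sigma> = a * sin \<phi>" using a c by simp
  then show "h = a * tanh (a * (s + C))" unfolding t using \<sigma> by auto
qed

text \<open>The scaled time is \<open>elliptic_F (\<sigma> * \<phi>) \<gamma>\<close>, so the
  amplitude is the signed angle. As cn is even and sd odd, the sign survives only in
  \<open>h\<close>, where it matches the sign of the velocity.\<close>

lemma pendulum_cn:
  assumes \<phi>: "0 < \<phi>" "\<phi> < pi / 2" and a: "a > 0" and \<sigma>: "\<sigma> \<in> {1, -1::real}" and \<gamma>: "\<gamma> \<in> {0<..<1}"
    and s: "s = \<sigma> * \<gamma> / a * arccn (cos \<phi>) \<gamma> - C"
    and h: "h * (\<sigma> * sqrt ((a / \<gamma>)\<^sup>2 - a\<^sup>2 * (sin \<phi>)\<^sup>2)) = a\<^sup>2 * sin \<phi> * cos \<phi>"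
  shows "jacobi_cn (a / \<gamma> * (s + C)) \<gamma> = cos \<phi>"
    "h = \<gamma> * a * jacobi_sd (a / \<gamma> * (s + C)) \<gamma> * jacobi_cn (a / \<gamma> * (s + C)) \<gamma>"
proof -
  have "a / \<gamma> * (s + C) = \<sigma> * elliptic_F \<phi> \<gamma>" using a \<gamma> by (simp add: s arccn_cos[OF \<gamma> \<phi>])
  also have "\<dots> = elliptic_F (\<sigma> * \<phi>) \<gamma>" using \<sigma> elliptic_F_minus[OF \<gamma>] by auto
  finally have am: "jacobi_am (a / \<gamma> * (s + C)) \<gamma> = \<sigma> * \<phi>"
    using jacobi_am_elliptic_F[OF \<gamma>] by simp
  show cn: "jacobi_cn (a / \<gamma> * (s + C)) \<gamma> = cos \<phi>"
    unfolding jacobi_cn_def am using \<sigma> by auto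
  define q where "q = sqrt (1 - \<gamma>\<^sup>2 * (sin \<phi>)\<^sup>2)"
  have q: "q > 0" using elliptic_integrand_pos[OF \<gamma>] by (simp add: q_def)
  have sd: "jacobi_sd (a / \<gamma> * (s + C)) \<gamma> = \<sigma> * sin \<phi> / q"
    unfolding jacobi_sd_def jacobi_sn_def jacobi_dn_def am q_def using \<sigma> by auto
  have "(a / \<gamma>)\<^sup>2 - a\<^sup>2 * (sin \<phi>)\<^sup>2 = (a / \<gamma>)\<^sup>2 * (1 - \<gamma>\<^sup>2 * (sin \<phi>)\<^sup>2)"
    using \<gamma> by (simp add: field_simps)
  then have "sqrt ((a / \<gamma>)\<^sup>2 - a\<^sup>2 * (sin \<phi>)\<^sup>2) = a / \<gamma> * q"
    using a \<gamma> by (simp only: real_sqrt_mult q_def) simp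
  with h have "h * (\<sigma> * (a / \<gamma> * q)) = a\<^sup>2 * sin \<phi> * cos \<phi>" by simp
  then have "h * \<sigma> * q = \<gamma> * a * sin \<phi> * cos \<phi>"
    using a \<gamma> by (simp add: field_simps power2_eq_square)
  then show "h = \<gamma> * a * jacobi_sd (a / \<gamma> * (s + C)) \<gamma> * jacobi_cn (a / \<gamma> * (s + C)) \<gamma>"
    unfolding sd cn using \<sigma> q by (auto simp: field_simps)
qed

text \<open>The amplitude is now \<open>\<sigma> * arcsin (sin \<phi> / \<gamma>)\<close>. Its dn is
  \<open>cos \<phi>\<close>, and its cosine is the factor \<open>sqrt (1 - q\<^sup>2)\<close> of the
  speed that has to be divided out of the equation for \<open>h\<close>.\<close>

lemma pendulum_dn:
  assumes \<phi>: "0 < \<phi>" "\<phi> < pi / 2" and a: "a > 0" and \<sigma>: "\<sigma> \<in> {1, -1::real}" and \<gamma>: "\<gamma> \<in> {0<..<1}"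
    and lt: "(a * \<gamma>)\<^sup>2 - a\<^sup>2 * (sin \<phi>)\<^sup>2 > 0"
    and s: "s = \<sigma> / a * arcdn (cos \<phi>) \<gamma> - C"
    and h: "h * (\<sigma> * sqrt ((a * \<gamma>)\<^sup>2 - a\<^sup>2 * (sin \<phi>)\<^sup>2)) = a\<^sup>2 * sin \<phi> * cos \<phi>"
  shows "jacobi_dn (a * (s + C)) \<gamma> = cos \<phi>"
    "h = a * jacobi_sc (a * (s + C)) \<gamma> * jacobi_dn (a * (s + C)) \<gamma>"
proof -
  have c: "0 < cos \<phi>" using \<phi> by (intro cos_gt_zero) auto
  have si: "0 < sin \<phi>" using \<phi> by (intro sin_gt_zero) auto
  have "a\<^sup>2 * (sin \<phi>)\<^sup>2 < a\<^sup>2 * \<gamma>\<^sup>2"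
    using lt by (simp add: power_mult_distrib)
  then have "(sin \<phi>)\<^sup>2 < \<gamma>\<^sup>2" using a by simp
  then have sg: "sin \<phi> < \<gamma>" using \<gamma> by (simp add: power_less_imp_less_base)
  define q where "q = sin \<phi> / \<gamma>"
  have q: "0 < q" "q < 1" using si sg \<gamma> by (auto simp: q_def)
  have q1: "sqrt (1 - q\<^sup>2) > 0" using q by (simp add: power_less_one_iff)
  have "a * (s + C) = \<sigma> * elliptic_F (arcsin q) \<gamma>" using a \<gamma> by (simp add: s arcdn_cos[OF \<gamma> \<phi> sg] q_def)
  also have "\<dots> = elliptic_F (\<sigma> * arcsin q) \<gamma>" using \<sigma> elliptic_F_minus[OF \<gamma>] by auto
  finally have am: "jacobi_am (a * (s + C)) \<gamma> = \<sigma> * arcsin q"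
    using jacobi_am_elliptic_F[OF \<gamma>] by simp
  have "jacobi_dn (a * (s + C)) \<gamma> = sqrt (1 - \<gamma>\<^sup>2 * q\<^sup>2)"
    unfolding jacobi_dn_def am using \<sigma> q by auto
  also have "1 - \<gamma>\<^sup>2 * q\<^sup>2 = (cos \<phi>)\<^sup>2"
    using \<gamma> by (simp add: q_def power_divide cos_squared_eq)
  finally show dn: "jacobi_dn (a * (s + C)) \<gamma> = cos \<phi>"
    using c by simp
  have sc: "jacobi_sc (a * (s + C)) \<gamma> = \<sigma> * q / sqrt (1 - q\<^sup>2)"
    unfolding jacobi_sc_def jacobi_sn_def jacobi_cn_def am using \<sigma> q by (auto simp: cos_arcsin)
  have "(a * \<gamma>)\<^sup>2 - a\<^sup>2 * (sin \<phi>)\<^sup>2 = (a * \<gamma>)\<^sup>2 * (1 - q\<^sup>2)"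
    using \<gamma> by (simp add: q_def field_simps)
  then have "sqrt ((a * \<gamma>)\<^sup>2 - a\<^sup>2 * (sin \<phi>)\<^sup>2) = a * \<gamma> * sqrt (1 - q\<^sup>2)"
    using a \<gamma> by (simp only: real_sqrt_mult) simp
  with h have "h * (\<sigma> * (a * \<gamma> * sqrt (1 - q\<^sup>2))) = a\<^sup>2 * (\<gamma> * q) * cos \<phi>"
    using \<gamma> by (simp add: q_def)
  then have "h * \<sigma> * sqrt (1 - q\<^sup>2) = a * q * cos \<phi>"
    using a \<gamma> by (simp add: field_simps power2_eq_square)
  then show "h = a * jacobi_sc (a * (s + C)) \<gamma> * jacobi_dn (a * (s + C)) \<gamma>"
    unfolding sc dn using \<sigma> q1 by (auto simp: field_simps)
qed

text \<open>Two conserved quantities: the energy in the time \<open>s\<close>, and the difference of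
  the kinetic energies in the times \<open>s\<close> and \<open>g(s)\<close>, the velocity in the
  latter being \<open>\<psi> / g'\<close>. This difference is
  \<open>\<psi>\<^sup>2 * (1 - 1 / g'\<^sup>2)\<close>, nonzero since \<open>g'\<^sup>2\<close> is
  never 1.\<close>

lemma pendulum_pair:
  fixes \<phi> \<psi> h g' g'' :: "real \<Rightarrow> real"
  assumes I: "convex I" "I \<noteq> {}"
    and d\<phi>: "\<And>s. s \<in> I \<Longrightarrow> (\<phi> has_real_derivative \<psi> s) (at s within I)"
    and d\<psi>: "\<And>s. s \<in> I \<Longrightarrow> (\<psi> has_real_derivative - h s * \<psi> s) (at s within I)"
    and h: "\<And>s. s \<in> I \<Longrightarrow> h s * \<psi> s = a\<^sup>2 * sin (\<phi> s) * cos (\<phi> s)"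
    and \<psi>0: "\<And>s. s \<in> I \<Longrightarrow> \<psi> s \<noteq> 0"
    and dg': "\<And>s. s \<in> I \<Longrightarrow> (g' has_real_derivative h s * (g' s ^ 3 - g' s)) (at s within I)"
    and g'0: "\<And>s. s \<in> I \<Longrightarrow> g' s ^ 3 - g' s \<noteq> 0"
  shows "\<exists>E E'. E \<noteq> E' \<and> (\<forall>s\<in>I. (\<psi> s)\<^sup>2 = E - a\<^sup>2 * (sin (\<phi> s))\<^sup>2) \<and>
    (\<forall>s\<in>I. (\<psi> s / g' s)\<^sup>2 = E' - a\<^sup>2 * (sin (\<phi> s))\<^sup>2)"
proof -
  have g0: "g' s \<noteq> 0" "(g' s)\<^sup>2 \<noteq> 1" if "s \<in> I" for s
    using g'0[OF that] by (auto simp: power3_eq_cube power2_eq_square)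
  have "((\<lambda>s. (\<psi> s)\<^sup>2 + a\<^sup>2 * (sin (\<phi> s))\<^sup>2) has_real_derivative 0) (at s within I)" if s: "s \<in> I" for s
  proof -
    have "((\<lambda>s. (\<psi> s)\<^sup>2 + a\<^sup>2 * (sin (\<phi> s))\<^sup>2) has_real_derivative
        2 * \<psi> s * (- h s * \<psi> s) + a\<^sup>2 * (2 * sin (\<phi> s) * (cos (\<phi> s) * \<psi> s))) (at s within I)"
      by (rule derivative_eq_intros d\<phi>[OF s] d\<psi>[OF s] refl | simp)+
    moreover have "2 * \<psi> s * (- h s * \<psi> s) + a\<^sup>2 * (2 * sin (\<phi> s) * (cos (\<phi> s) * \<psi> s)) = 0"
      using h[OF s] by algebra
    ultimately show ?thesis by (simp only:)
  qed
  from has_field_derivative_zero_constant[OF I(1) this]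
  obtain E where E: "\<And>s. s \<in> I \<Longrightarrow> (\<psi> s)\<^sup>2 + a\<^sup>2 * (sin (\<phi> s))\<^sup>2 = E" by blast
  have "((\<lambda>s. (\<psi> s)\<^sup>2 - (\<psi> s / g' s)\<^sup>2) has_real_derivative 0) (at s within I)" if s: "s \<in> I" for s
  proof -
    \<comment> \<open>The equation for \<open>g'\<close> reduces the derivative of
      \<open>\<psi> / g'\<close> to \<open>- h * \<psi> * g'\<close>, so both squares have
      derivative \<open>- 2 * h * \<psi>\<^sup>2\<close>.\<close>
    note q = DERIV_divide[OF d\<psi>[OF s] dg'[OF s] g0(1)[OF s]]
    show ?thesis
      by (rule DERIV_cong[OF DERIV_diff[OF DERIV_power[OF d\<psi>[OF s], of 2] DERIV_power[OF q, of 2]]])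
        (use g0(1)[OF s] in \<open>simp add: field_simps power3_eq_cube\<close>)
  qed
  from has_field_derivative_zero_constant[OF I(1) this]
  obtain D where D: "\<And>s. s \<in> I \<Longrightarrow> (\<psi> s)\<^sup>2 - (\<psi> s / g' s)\<^sup>2 = D" by blast
  have "D \<noteq> 0"
  proof -
    obtain s where s: "s \<in> I" using I(2) by auto
    show ?thesis
      using D[OF s] \<psi>0[OF s] g0[OF s] by (auto simp: power_divide field_simps)
  qed
  then show ?thesis
    using E D by (intro exI[of _ E] exI[of _ "E - D"]) (auto simp: algebra_simps)
qed

section \<open>The associated holomorphic function\<close>

lemma connected_nonzero_constant_sign:
  fixes f :: "'a::topological_space \<Rightarrow> real"
  assumes "connected S" "continuous_on S f" "\<And>x. x \<in> S \<Longrightarrow> f x \<noteq> 0"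
  obtains \<sigma> :: real where "\<sigma> \<in> {1, -1}" "\<And>x. x \<in> S \<Longrightarrow> f x = \<sigma> * \<bar>f x\<bar>"
proof -
  have "connected (f ` S)"
    using assms by (intro connected_continuous_image) auto
  moreover have "0 \<notin> f ` S" using assms(3) by force
  ultimately have "\<not> (f x < 0 \<and> 0 < f y)" if "x \<in> S" "y \<in> S" for x y
    using connectedD_interval[of "f ` S" "f x" "f y" 0] that by auto
  then have "(\<forall>x\<in>S. f x > 0) \<or> (\<forall>x\<in>S. f x < 0)"
    using assms(3) by (meson linorder_neqE_linordered_idom)
  then show ?thesis
  proof
    assume "\<forall>x\<in>S. f x > 0"
    then show ?thesis by (intro that[of 1]) auto
  next
    assume "\<forall>x\<in>S. f x < 0"
    then show ?thesis by (intro that[of "-1"]) force+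
  qed
qed

text \<open>\<open>cayley (exp w)\<close> is \<open>tanh (w / 2)\<close>, written without half arguments.\<close>

definition cayley :: "complex \<Rightarrow> complex" where
  "cayley E = (E - 1) / (E + 1)"

lemma tanh_half: "tanh (w / 2) = cayley (exp w)" for w :: complex
proof -
  have e: "exp w = exp (w / 2) * exp (w / 2)" by (simp add: exp_add[symmetric])
  have "sinh (w / 2) = (exp w - 1) / (2 * exp (w / 2))"
    unfolding e by (simp add: sinh_field_def exp_minus field_simps)
  moreover have "cosh (w / 2) = (exp w + 1) / (2 * exp (w / 2))"
    unfolding e by (simp add: cosh_field_def exp_minus field_simps)
  ultimately show ?thesis by (simp add: tanh_def cayley_def)
qed

text \<open>Since coth is the reciprocal of tanh, the second factor is the reciprocal of the
  conjugate of the first; with division by zero giving zero this covers zeros and poles as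
  well.\<close>

lemma wall_arg_eq:
  "wall_arg r c1 z = cayley (exp (r * (z + c1))) / cnj (cayley (exp (r * (z + c1))))"
proof -
  have "wall_arg r c1 z = tanh (r * (z + c1) / 2) * inverse (tanh (cnj (r * (z + c1)) / 2))"
    by (simp add: wall_arg_def coth_def tanh_def)
  then show ?thesis
    unfolding tanh_half by (simp add: exp_cnj cayley_def divide_inverse mult_ac)
qed

text \<open>With \<alpha> an argument of \<open>T\<close>, the quotient \<open>T / cnj T\<close> is
  exp(2 i \<alpha>), and 1 + cos(2 \<alpha>) is twice the square of cos \<alpha>. So the wall
  function is the absolute cosine of the argument of \<open>T\<close>.\<close>

lemma wall_eq:
  assumes T: "T = cayley (exp (r * (z + c1)))" "T \<noteq> 0"
  shows "cmod (wall_arg r c1 z) = 1" "wall r c1 z = \<bar>Re T\<bar> / cmod T"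
proof -
  define X where "X = T / cnj T"
  have wX: "wall_arg r c1 z = X" by (simp add: wall_arg_eq X_def T)
  have X: "cmod X = 1" using T(2) by (simp add: X_def norm_divide)
  then show "cmod (wall_arg r c1 z) = 1" by (simp add: wX)
  have "X \<noteq> 0" using X by auto
  then have "cosh (Ln X) = (X + inverse X) / 2"
    by (simp add: cosh_field_def exp_minus)
  also have "inverse X = cnj X" using T(2) by (simp add: X_def field_simps)
  finally have "cosh (Ln X) = (X + cnj X) / 2" .
  then have c: "Re (cosh (Ln X)) = Re X" by (simp only: complex_add_cnj) simp
  have "X = T\<^sup>2 / of_real ((cmod T)\<^sup>2)"
    unfolding X_def complex_norm_square using T(2) by (simp add: power2_eq_square)
  then have "Re X = ((Re T)\<^sup>2 - (Im T)\<^sup>2) / (cmod T)\<^sup>2"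
    by (simp add: Re_divide_of_real power2_eq_square)
  then have "1 + Re X = ((cmod T)\<^sup>2 + ((Re T)\<^sup>2 - (Im T)\<^sup>2)) / (cmod T)\<^sup>2"
    using T(2) by (simp only: add_divide_distrib) simp
  also have "(cmod T)\<^sup>2 + ((Re T)\<^sup>2 - (Im T)\<^sup>2) = 2 * (Re T)\<^sup>2"
    by (simp add: cmod_power2)
  finally have "1 + Re X = 2 * (Re T / cmod T)\<^sup>2"
    by (simp add: power_divide)
  then have "wall r c1 z = 1 / sqrt 2 * sqrt (2 * (Re T / cmod T)\<^sup>2)"
    by (simp add: wall_def wX c)
  also have "\<dots> = \<bar>Re T\<bar> / cmod T"
    by (simp add: real_sqrt_mult)
  finally show "wall r c1 z = \<bar>Re T\<bar> / cmod T" .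
qed

lemma cayley_parts:
  "Re (cayley E) = ((cmod E)\<^sup>2 - 1) / (cmod (E + 1))\<^sup>2"
  "Im (cayley E) = 2 * Im E / (cmod (E + 1))\<^sup>2"
  unfolding cayley_def
  by (simp_all add: Re_divide Im_divide cmod_power2 algebra_simps)
    (simp_all add: power2_eq_square algebra_simps)

text \<open>The denominators combine through \<open>E\<^sup>2 - 1 = (E - 1) * (E + 1)\<close>; at
  \<open>E = 1\<close> both sides are 0. The numerator is the expression that reappears in
  \<open>Re_cosh_formula\<close>.\<close>

lemma Re_times_Im_cayley:
  assumes "E + 1 \<noteq> 0"
  shows "Re (cayley E) * Im (cayley E) / (cmod (cayley E))\<^sup>2 =
    2 * Im E * ((cmod E)\<^sup>2 - 1) / (cmod (E\<^sup>2 - 1))\<^sup>2"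
proof -
  have "E\<^sup>2 - 1 = (E - 1) * (E + 1)" by (simp add: power2_eq_square algebra_simps)
  then have "cmod (E\<^sup>2 - 1) = cmod (E - 1) * cmod (E + 1)" by (simp add: norm_mult)
  moreover have "cmod (cayley E) = cmod (E - 1) / cmod (E + 1)" by (simp add: cayley_def norm_divide)
  moreover have "cmod (E + 1) > 0" using assms by simp
  ultimately show ?thesis
    unfolding cayley_parts
    by (cases "cmod (E - 1) = 0") (simp_all add: field_simps power2_eq_square)
qed

text \<open>For \<open>E = exp w\<close> the quotient \<open>(1 + E\<^sup>2) / (2 * E)\<close> is
  \<open>cosh w\<close>, and the factor \<open>- \<i> * c\<close> turns its imaginary part into a
  real part. This evaluates the real part of \<open>A'' / A'\<^sup>2\<close>.\<close>

lemma Re_cosh_formula: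
  assumes "E \<noteq> 0"
  shows "Re (- \<i> * of_real c * (1 + E\<^sup>2) / (2 * E)) = c * (Im E * ((cmod E)\<^sup>2 - 1)) / (2 * (cmod E)\<^sup>2)"
proof -
  have "(1 + E\<^sup>2) / (2 * E) = (cnj E + of_real ((cmod E)\<^sup>2) * E) / of_real (2 * (cmod E)\<^sup>2)"
  proof -
    have "of_real (2 * (cmod E)\<^sup>2) = 2 * (E * cnj E)" "of_real ((cmod E)\<^sup>2) = E * cnj E"
      by (simp_all only: complex_norm_square[symmetric] of_real_mult of_real_numeral)
    then show ?thesis using assms by (simp only:) (simp add: field_simps power2_eq_square)
  qed
  then have "Im ((1 + E\<^sup>2) / (2 * E)) = Im E * ((cmod E)\<^sup>2 - 1) / (2 * (cmod E)\<^sup>2)"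
    by (simp only: Im_divide_of_real) (simp add: algebra_simps)
  moreover have "Re (- \<i> * of_real c * (1 + E\<^sup>2) / (2 * E)) = c * Im ((1 + E\<^sup>2) / (2 * E))"
  proof -
    have "Re (- \<i> * of_real c * w) = c * Im w" for w by simp
    from this[of "(1 + E\<^sup>2) / (2 * E)"] show ?thesis by (simp only: times_divide_eq_right)
  qed
  ultimately show ?thesis by simp
qed

text \<open>The Moebius transform \<open>(\<beta> - r) / (\<beta> + r)\<close> linearizes the
  Riccati equation: its derivative is \<open>2 * r\<close> times itself. The conclusion is
  \<open>\<beta> = - r coth w\<close> with \<open>w = r * (z + c1)\<close>, cleared of
  denominators.\<close>

lemma holomorphic_riccati_solution:
  fixes \<beta> :: "complex \<Rightarrow> complex"
  assumes \<Omega>: "open \<Omega>" "connected \<Omega>" "\<Omega> \<noteq> {}"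
    and d\<beta>: "\<And>z. z \<in> \<Omega> \<Longrightarrow> (\<beta> has_field_derivative (\<beta> z)\<^sup>2 - r\<^sup>2) (at z)"
    and ne: "\<And>z. z \<in> \<Omega> \<Longrightarrow> (\<beta> z)\<^sup>2 \<noteq> r\<^sup>2" and r: "r \<noteq> 0"
  obtains c1 where "\<And>z. z \<in> \<Omega> \<Longrightarrow>
    \<beta> z * (1 - (exp (r * (z + c1)))\<^sup>2) = r * (1 + (exp (r * (z + c1)))\<^sup>2)"
proof -
  have nz: "\<beta> z - r \<noteq> 0" "\<beta> z + r \<noteq> 0" if "z \<in> \<Omega>" for z
    using ne[OF that] by (auto simp: power2_eq_square eq_neg_iff_add_eq_0[symmetric])
  define M where "M z = (\<beta> z - r) / (\<beta> z + r) * exp (- 2 * r * z)" for z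
  have dM: "(M has_field_derivative 0) (at z)" if z: "z \<in> \<Omega>" for z
  proof -
    have "(M has_field_derivative
      ((((\<beta> z)\<^sup>2 - r\<^sup>2) * (\<beta> z + r) - (\<beta> z - r) * ((\<beta> z)\<^sup>2 - r\<^sup>2)) / ((\<beta> z + r) * (\<beta> z + r))) * exp (- 2 * r * z)
      + exp (- 2 * r * z) * (- 2 * r) * ((\<beta> z - r) / (\<beta> z + r))) (at z)"
      unfolding M_def
      by (rule derivative_eq_intros d\<beta>[OF z] nz[OF z] refl | simp)+
    moreover have "((((\<beta> z)\<^sup>2 - r\<^sup>2) * (\<beta> z + r) - (\<beta> z - r) * ((\<beta> z)\<^sup>2 - r\<^sup>2)) / ((\<beta> z + r) * (\<beta> z + r))) =
      2 * r * ((\<beta> z - r) / (\<beta> z + r))"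
    proof -
      have "((\<beta> z)\<^sup>2 - r\<^sup>2) * (\<beta> z + r) - (\<beta> z - r) * ((\<beta> z)\<^sup>2 - r\<^sup>2) =
          2 * r * (\<beta> z - r) * (\<beta> z + r)" by algebra
      then show ?thesis using nz[OF z] by simp
    qed
    ultimately show ?thesis by simp
  qed
  have "continuous_on \<Omega> M"
    using dM by (intro continuous_at_imp_continuous_on) (auto intro: DERIV_isCont)
  then obtain q where q: "\<And>z. z \<in> \<Omega> \<Longrightarrow> M z = q"
    using DERIV_zero_connected_constant[OF \<Omega>(2,1) finite.emptyI, of M] dM by auto
  have "q \<noteq> 0" using \<Omega>(3) q nz by (force simp: M_def)
  \<comment> \<open>The shift \<open>c1\<close> absorbs the nonzero constant of integration
    \<open>q\<close> into the exponential.\<close>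
  define c1 where "c1 = Ln q / (2 * r)"
  show ?thesis
  proof (rule that[of c1])
    fix z assume z: "z \<in> \<Omega>"
    have "2 * (r * (z + c1)) = 2 * r * z + Ln q"
      using r by (simp add: c1_def distrib_left)
    then have "(exp (r * (z + c1)))\<^sup>2 = exp (2 * r * z) * exp (Ln q)"
      by (simp only: exp_double[symmetric] exp_add[symmetric])
    also have "\<dots> = (\<beta> z - r) / (\<beta> z + r)"
      using \<open>q \<noteq> 0\<close> q[OF z, symmetric] by (simp add: M_def exp_minus)
    finally have "(exp (r * (z + c1)))\<^sup>2 = (\<beta> z - r) / (\<beta> z + r)" .
    then show "\<beta> z * (1 - (exp (r * (z + c1)))\<^sup>2) = r * (1 + (exp (r * (z + c1)))\<^sup>2)"
      using nz[OF z] by (simp add: field_simps)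
  qed
qed

text \<open>Translates the complex data into a single real angle \<open>\<theta>\<close>. The sign
  \<open>\<eta>\<close> is the product of the sign \<open>\<delta>\<close> left open by a square
  root and the sign \<open>\<omega>\<close> of the imaginary part of \<open>L\<close>.\<close>

lemma wall_angle:
  fixes \<Omega> :: "complex set" and A :: "complex \<Rightarrow> complex" and k :: real and c0 r :: complex
  defines "a \<equiv> sqrt (cmod c0)" and "\<mu> \<equiv> sqrt (- k)"
  defines "\<rho> \<equiv> \<lambda>z. 2 * Re (deriv (deriv A) z / (deriv A z)\<^sup>2) * (cmod (deriv A z))\<^sup>2"
  assumes \<Omega>: "open \<Omega>" "connected \<Omega>" "\<Omega> \<noteq> {}"
    and A: "A holomorphic_on \<Omega>" and A': "\<And>z. z \<in> \<Omega> \<Longrightarrow> deriv A z \<noteq> 0"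
    and cst: "associated_constants \<Omega> A k c0" and k: "k < 0" and r: "r\<^sup>2 = c0"
    and \<rho>: "\<And>z. z \<in> \<Omega> \<Longrightarrow> \<rho> z \<noteq> 0"
  shows "c0 \<noteq> 0 \<and> (\<exists>c1 \<theta> \<eta> C. \<eta> \<in> {1, -1} \<and>
    (\<forall>z\<in>\<Omega>. cmod (wall_arg r c1 z) = 1 \<and> wall r c1 z = cos (\<theta> z) \<and>
      0 < \<theta> z \<and> \<theta> z < pi / 2 \<and>
      2 * Re (A z) = \<eta> * (2 / \<mu>) * \<theta> z + C \<and> \<rho> z = \<eta> * (a\<^sup>2 / \<mu>) * sin (2 * \<theta> z)))"
proof -
  define \<beta> where "\<beta> z = deriv (deriv A) z / deriv A z" for z
  have hol: "deriv A holomorphic_on \<Omega>" "deriv (deriv A) holomorphic_on \<Omega>"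
    using A \<Omega>(1) by (auto intro: holomorphic_deriv)
  have dA: "(A has_field_derivative deriv A z) (at z)"
    "(deriv A has_field_derivative deriv (deriv A) z) (at z)"
    "(deriv (deriv A) has_field_derivative deriv (deriv (deriv A)) z) (at z)" if "z \<in> \<Omega>" for z
    using that A hol \<Omega>(1) by (auto intro: holomorphic_derivI)
  have \<beta>2: "(\<beta> z)\<^sup>2 - r\<^sup>2 = of_real k * (deriv A z)\<^sup>2" if "z \<in> \<Omega>" for z
    using cst that by (auto simp: associated_constants_def \<beta>_def r)
  have \<mu>: "\<mu> > 0" "\<mu>\<^sup>2 = - k" using k by (auto simp: \<mu>_def)
  have \<rho>_eq: "\<rho> z = 2 * Re (\<beta> z / deriv A z) * (cmod (deriv A z))\<^sup>2" for z
    by (simp add: \<rho>_def \<beta>_def power2_eq_square)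
  \<comment> \<open>For \<open>r = 0\<close> the square of \<open>\<beta> / A'\<close> would be the
    negative number \<open>k\<close>, so \<open>\<beta> / A'\<close> would be purely imaginary and
    \<open>\<rho>\<close> would vanish.\<close>
  have r0: "r \<noteq> 0"
  proof
    assume "r = 0"
    obtain z where z: "z \<in> \<Omega>" using \<Omega> by auto
    have "(\<beta> z / deriv A z)\<^sup>2 = of_real k"
      using \<beta>2[OF z] A'[OF z] \<open>r = 0\<close> by (simp add: power_divide)
    also have "\<dots> = (\<i> * of_real \<mu>)\<^sup>2" using \<mu>(2) by (simp add: power_mult_distrib flip: of_real_power)
    finally have "Re (\<beta> z / deriv A z) = 0"
      unfolding power2_eq_iff by auto
    then show False using \<rho>[OF z] by (simp add: \<rho>_eq)
  qed
  have d\<beta>: "(\<beta> has_field_derivative (\<beta> z)\<^sup>2 - r\<^sup>2) (at z)" if z: "z \<in> \<Omega>" for z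
  proof -
    have "(\<beta> has_field_derivative (deriv (deriv (deriv A)) z * deriv A z - deriv (deriv A) z * deriv (deriv A) z)
        / (deriv A z * deriv A z)) (at z)"
      unfolding \<beta>_def by (rule DERIV_divide[OF dA(3)[OF z] dA(2)[OF z] A'[OF z]])
    also have "deriv (deriv (deriv A)) z * deriv A z - deriv (deriv A) z * deriv (deriv A) z =
        of_real k * deriv A z ^ 4"
      using cst z by (simp add: associated_constants_def power2_eq_square)
    also have "of_real k * deriv A z ^ 4 / (deriv A z * deriv A z) = (\<beta> z)\<^sup>2 - r\<^sup>2"
      unfolding \<beta>2[OF z] using A'[OF z] by (simp add: power2_eq_square power4_eq_xxxx)
    finally show ?thesis .
  qed
  have ne: "(\<beta> z)\<^sup>2 \<noteq> r\<^sup>2" if "z \<in> \<Omega>" for z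
    using \<beta>2[OF that] A'[OF that] k by auto
  obtain c1 where c1: "\<And>z. z \<in> \<Omega> \<Longrightarrow>
    \<beta> z * (1 - (exp (r * (z + c1)))\<^sup>2) = r * (1 + (exp (r * (z + c1)))\<^sup>2)"
    using holomorphic_riccati_solution[OF \<Omega> d\<beta> ne r0] by blast
  \<comment> \<open>\<open>E\<close> is \<open>exp w\<close>, and the hyperbolic functions of
    \<open>w\<close> become rational in \<open>E\<close>; for instance \<open>r / sinh w\<close> is
    \<open>2 * r * E / (E\<^sup>2 - 1)\<close>.\<close>
  define E where "E z = exp (r * (z + c1))" for z
  have E0: "E z \<noteq> 0" for z by (simp add: E_def)
  have dE: "(E has_field_derivative r * E z) (at z)" for z
    unfolding E_def by (auto intro!: derivative_eq_intros)
  have \<beta>E: "\<beta> z * (1 - (E z)\<^sup>2) = r * (1 + (E z)\<^sup>2)" if "z \<in> \<Omega>" for z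
    using c1[OF that] by (simp add: E_def)
  have E1: "(E z)\<^sup>2 \<noteq> 1" if "z \<in> \<Omega>" for z
    using \<beta>E[OF that] r0 by auto
  then have E1': "E z - 1 \<noteq> 0" "E z + 1 \<noteq> 0" if "z \<in> \<Omega>" for z
    using that by (auto simp: power2_eq_1_iff eq_neg_iff_add_eq_0)
  \<comment> \<open>\<open>A' sinh w\<close> is constant, because \<open>A'' = \<beta> A'\<close> and \<open>\<beta> = - r coth w\<close>\<close>
  define K where "K z = deriv A z * ((E z)\<^sup>2 - 1) / E z" for z
  have dK: "(K has_field_derivative 0) (at z)" if z: "z \<in> \<Omega>" for z
  proof -
    have "deriv (deriv A) z = \<beta> z * deriv A z" using A'[OF z] by (simp add: \<beta>_def)
    with dA(2)[OF z] have dA': "(deriv A has_field_derivative \<beta> z * deriv A z) (at z)" by simp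
    have "(K has_field_derivative
      ((\<beta> z * deriv A z * ((E z)\<^sup>2 - 1) + 2 * E z * (r * E z) * deriv A z) * E z
        - deriv A z * ((E z)\<^sup>2 - 1) * (r * E z)) / (E z * E z)) (at z)"
      unfolding K_def
      by (rule derivative_eq_intros dA' dE E0 refl | simp)+
    moreover have "(\<beta> z * deriv A z * ((E z)\<^sup>2 - 1) + 2 * E z * (r * E z) * deriv A z) * E z
        - deriv A z * ((E z)\<^sup>2 - 1) * (r * E z) = 0"
      using \<beta>E[OF z] by algebra
    ultimately show ?thesis by simp
  qed
  have "continuous_on \<Omega> K"
    using dK by (intro continuous_at_imp_continuous_on) (auto intro: DERIV_isCont)
  then obtain q where q: "\<And>z. z \<in> \<Omega> \<Longrightarrow> K z = q"
    using DERIV_zero_connected_constant[OF \<Omega>(2,1) finite.emptyI, of K] dK by auto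
  \<comment> \<open>Inserting the solution \<open>\<beta>\<close> into
    \<open>\<beta>\<^sup>2 - r\<^sup>2 = k * A'\<^sup>2\<close> gives
    \<open>k * K\<^sup>2 = 4 * r\<^sup>2\<close>. As \<open>k\<close> is the square of
    \<open>\<i> * \<mu>\<close>, this fixes \<open>q\<close> up to a sign.\<close>
  have "(\<i> * of_real \<mu> * q)\<^sup>2 = (2 * r)\<^sup>2"
  proof -
    obtain z where z: "z \<in> \<Omega>" using \<Omega> by auto
    have "of_real k * (deriv A z)\<^sup>2 * (1 - (E z)\<^sup>2)\<^sup>2 = (2 * r * E z)\<^sup>2"
      using \<beta>2[OF z] \<beta>E[OF z] by algebra
    then have "of_real k * (K z)\<^sup>2 = (2 * r)\<^sup>2"
      unfolding K_def using E0[of z] by (simp add: field_simps power2_eq_square)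
    moreover have "of_real k = (\<i> * of_real \<mu>)\<^sup>2" using \<mu>(2) by (simp add: power_mult_distrib flip: of_real_power)
    ultimately show ?thesis using q[OF z] by (simp add: power_mult_distrib)
  qed
  then obtain \<delta> :: real where \<delta>: "\<delta> \<in> {1, -1}" "\<i> * of_real \<mu> * q = of_real \<delta> * (2 * r)"
    unfolding power2_eq_iff by (metis insertCI mult_1 mult_minus1 of_real_1 of_real_minus)
  have A'E: "\<i> * of_real \<mu> * deriv A z = of_real \<delta> * (2 * r * E z / ((E z)\<^sup>2 - 1))" if z: "z \<in> \<Omega>" for z
    using q[OF z] \<delta>(2) E0[of z] E1[OF z] by (simp add: K_def field_simps)
  \<comment> \<open>The bracket is the logarithmic derivative of \<open>tanh (w / 2)\<close>; the
    factor before it is imaginary because \<open>k < 0\<close>.\<close>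
  have A'_eq: "deriv A z = - \<i> * of_real \<delta> / of_real \<mu> * (2 * r * E z / ((E z)\<^sup>2 - 1))" if z: "z \<in> \<Omega>" for z
  proof -
    have "deriv A z = - (\<i> / of_real \<mu>) * (\<i> * of_real \<mu> * deriv A z)" using \<mu>(1) by simp
    also note A'E[OF z]
    finally show ?thesis by simp
  qed
  have a: "a\<^sup>2 = (cmod r)\<^sup>2" by (simp add: a_def norm_power flip: r)
  define T where "T z = cayley (E z)" for z
  \<comment> \<open>\<open>X\<close> is sine times cosine of the argument of \<open>T\<close>, that
    is, half the sine of the doubled argument.\<close>
  define X where "X z = Re (T z) * Im (T z) / (cmod (T z))\<^sup>2" for z
  \<comment> \<open>Here \<open>\<beta> / A'\<close> is
    \<open>- \<i> * \<mu> * \<delta> * cosh w\<close>. Both sides then carry the factor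
    \<open>Im E * ((cmod E)\<^sup>2 - 1)\<close>, and only positive factors remain to be
    compared.\<close>
  have \<rho>X: "\<rho> z = \<delta> * (a\<^sup>2 / \<mu>) * (2 * X z)" if z: "z \<in> \<Omega>" for z
  proof -
    have "\<beta> z / deriv A z = - \<i> * of_real (\<mu> * \<delta>) * (1 + (E z)\<^sup>2) / (2 * E z)"
    proof -
      have "\<beta> z = r * (1 + (E z)\<^sup>2) / (1 - (E z)\<^sup>2)"
        using \<beta>E[OF z] E1[OF z] by (simp add: field_simps)
      moreover note A'_eq[OF z]
      moreover have i_div: "x / (\<i> * y) = - (\<i> * x / y)" for x y
        by (cases "y = 0") (simp_all add: field_simps)
      have "r * N / (- p) / (- \<i> * of_real \<delta> / of_real \<mu> * (2 * r * e / p)) =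
          - \<i> * of_real (\<mu> * \<delta>) * N / (2 * e)" if "p \<noteq> 0" for N p e
        using \<delta>(1) r0 \<mu>(1) that by (auto simp: i_div mult_ac)
      note this[of "(E z)\<^sup>2 - 1" "1 + (E z)\<^sup>2" "E z"]
      ultimately show ?thesis
        using E1[OF z] by simp
    qed
    then have 1: "Re (\<beta> z / deriv A z) = \<mu> * \<delta> * (Im (E z) * ((cmod (E z))\<^sup>2 - 1)) / (2 * (cmod (E z))\<^sup>2)"
      by (simp only: Re_cosh_formula[OF E0])
    have "\<mu> * cmod (deriv A z) = 2 * cmod r * cmod (E z) / cmod ((E z)\<^sup>2 - 1)"
      using arg_cong[OF A'E[OF z], of cmod] \<mu>(1) \<delta>(1) by (auto simp: norm_mult norm_divide)
    then have 2: "cmod (deriv A z) = 2 * cmod r * cmod (E z) / cmod ((E z)\<^sup>2 - 1) / \<mu>"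
      using \<mu>(1) by (metis nonzero_mult_div_cancel_left order_less_irrefl)
    have X: "X z = 2 * Im (E z) * ((cmod (E z))\<^sup>2 - 1) / (cmod ((E z)\<^sup>2 - 1))\<^sup>2"
      unfolding X_def T_def by (rule Re_times_Im_cayley[OF E1'(2)[OF z]])
    have "cmod (E z) > 0" "cmod ((E z)\<^sup>2 - 1) > 0" using E0 E1[OF z] by auto
    then show ?thesis
      unfolding \<rho>_eq 1 2 X a using \<mu>(1) by (simp add: field_simps power2_eq_square)
  qed
  \<comment> \<open>As \<open>\<rho>\<close> has no zeros, \<open>T\<close> avoids both coordinate
    axes, and connectedness of \<open>\<Omega>\<close> confines it to one open quadrant.\<close>
  have X0: "X z \<noteq> 0" if "z \<in> \<Omega>" for z
    using \<rho>[OF that] \<rho>X[OF that] by auto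
  then have T0: "Re (T z) \<noteq> 0" "Im (T z) \<noteq> 0" "T z \<noteq> 0" if "z \<in> \<Omega>" for z
    using that by (fastforce simp: X_def)+
  have dT: "(T has_field_derivative T z * (2 * r * E z / ((E z)\<^sup>2 - 1))) (at z)" if z: "z \<in> \<Omega>" for z
  proof -
    have "(T has_field_derivative (r * E z * (E z + 1) - (E z - 1) * (r * E z)) / ((E z + 1) * (E z + 1))) (at z)"
      unfolding T_def cayley_def
      by (rule derivative_eq_intros dE E1'[OF z] refl | simp)+
    also have "(r * E z * (E z + 1) - (E z - 1) * (r * E z)) / ((E z + 1) * (E z + 1)) =
        T z * (2 * r * E z / ((E z)\<^sup>2 - 1))"
    proof -
      have "(E z)\<^sup>2 - 1 = (E z - 1) * (E z + 1)" by (simp add: power2_eq_square algebra_simps)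
      moreover have "r * E z * (E z + 1) - (E z - 1) * (r * E z) = 2 * r * E z" by algebra
      ultimately show ?thesis using E1'[OF z] by (simp add: T_def cayley_def)
    qed
    finally show ?thesis .
  qed
  have contT: "continuous_on \<Omega> T"
    using dT by (intro continuous_at_imp_continuous_on) (auto intro: DERIV_isCont)
  \<comment> \<open>Multiplication by \<open>\<epsilon>\<close> moves \<open>T\<close> into the
    right half-plane, where the principal logarithm is holomorphic with imaginary part between -pi/2
    and pi/2.\<close>
  obtain \<epsilon> where \<epsilon>: "\<epsilon> \<in> {1, -1::real}" "\<And>z. z \<in> \<Omega> \<Longrightarrow> Re (T z) = \<epsilon> * \<bar>Re (T z)\<bar>"
    using connected_nonzero_constant_sign[OF \<Omega>(2), of "\<lambda>z. Re (T z)"] contT T0(1)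
    by (metis continuous_on_Re)
  have \<epsilon>T: "Re (of_real \<epsilon> * T z) = \<bar>Re (T z)\<bar>" "of_real \<epsilon> * T z \<noteq> 0" if "z \<in> \<Omega>" for z
    using \<epsilon>(1) \<epsilon>(2)[OF that] T0[OF that] by auto
  define L where "L z = Ln (of_real \<epsilon> * T z)" for z
  have dL: "(L has_field_derivative 2 * r * E z / ((E z)\<^sup>2 - 1)) (at z)" if z: "z \<in> \<Omega>" for z
  proof -
    have "of_real \<epsilon> * T z \<notin> \<real>\<^sub>\<le>\<^sub>0"
      using \<epsilon>T[OF z] T0[OF z] by (metis abs_le_zero_iff complex_nonpos_Reals_iff)
    from DERIV_chain2[OF has_field_derivative_Ln[OF this] DERIV_cmult[OF dT[OF z], of "of_real \<epsilon>"]]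
    have "(L has_field_derivative inverse (of_real \<epsilon> * T z) *
        (of_real \<epsilon> * (T z * (2 * r * E z / ((E z)\<^sup>2 - 1))))) (at z)"
      unfolding L_def .
    moreover have "inverse (of_real \<epsilon> * T z) * (of_real \<epsilon> * (T z * y)) = y" for y
      using left_inverse[OF \<epsilon>T(2)[OF z]] by (metis mult.assoc mult_1)
    ultimately show ?thesis by (simp only:)
  qed
  have contL: "continuous_on \<Omega> L"
    using dL by (intro continuous_at_imp_continuous_on) (auto intro: DERIV_isCont)
  have expL: "exp (L z) = of_real \<epsilon> * T z" if "z \<in> \<Omega>" for z
    using \<epsilon>T[OF that] by (simp add: L_def)
  have cmL: "exp (Re (L z)) = cmod (T z)" if "z \<in> \<Omega>" for z
    using arg_cong[OF expL[OF that], of cmod] \<epsilon>(1) by (auto simp: norm_mult)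
  have cosL: "cos (Im (L z)) = \<bar>Re (T z)\<bar> / cmod (T z)" if "z \<in> \<Omega>" for z
    using arg_cong[OF expL[OF that], of Re] \<epsilon>T(1)[OF that] cmL[OF that] T0(3)[OF that]
    by (simp add: Re_exp field_simps)
  have sinL: "sin (Im (L z)) = \<epsilon> * Im (T z) / cmod (T z)" if "z \<in> \<Omega>" for z
    using arg_cong[OF expL[OF that], of Im] cmL[OF that] T0(3)[OF that]
    by (simp add: Im_exp field_simps)
  have sin2L: "sin (2 * Im (L z)) = 2 * X z" if "z \<in> \<Omega>" for z
  proof -
    have "\<epsilon> * \<bar>Re (T z)\<bar> = Re (T z)" using \<epsilon>(2)[OF that] by simp
    then have "\<bar>Re (T z)\<bar> * \<epsilon> * Im (T z) = Re (T z) * Im (T z)" by (simp add: mult_ac)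
    then show ?thesis
      unfolding sin_double sinL[OF that] cosL[OF that] X_def by (simp add: power2_eq_square mult_ac)
  qed
  have ImL0: "Im (L z) \<noteq> 0" if "z \<in> \<Omega>" for z
    using sin2L[OF that] X0[OF that] by auto
  \<comment> \<open>The constant sign of \<open>Im L\<close> allows the passage to the positive
    angle \<open>\<theta>\<close> without losing smoothness.\<close>
  obtain \<omega> where \<omega>: "\<omega> \<in> {1, -1::real}" "\<And>z. z \<in> \<Omega> \<Longrightarrow> Im (L z) = \<omega> * \<bar>Im (L z)\<bar>"
    using connected_nonzero_constant_sign[OF \<Omega>(2), of "\<lambda>z. Im (L z)"] contL ImL0
    by (metis continuous_on_Im)
  define \<theta> where "\<theta> z = \<bar>Im (L z)\<bar>" for z
  have \<theta>: "Im (L z) = \<omega> * \<theta> z" if "z \<in> \<Omega>" for z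
    using \<omega>(2)[OF that] by (simp add: \<theta>_def)
  have \<theta>_range: "0 < \<theta> z" "\<theta> z < pi / 2" if "z \<in> \<Omega>" for z
    using ImL0[OF that] Re_Ln_pos_lt[OF \<epsilon>T(2)[OF that]] \<epsilon>T(1)[OF that] T0(1)[OF that]
    by (auto simp: \<theta>_def L_def)
  have cos\<theta>: "cos (\<theta> z) = wall r c1 z" "cmod (wall_arg r c1 z) = 1" if "z \<in> \<Omega>" for z
    using wall_eq[of "T z" r z c1] T0(3)[OF that] cosL[OF that]
    by (simp_all add: T_def E_def \<theta>_def)
  \<comment> \<open>\<open>D\<close> compares \<open>A\<close> with its logarithmic candidate. Its
    constancy makes \<open>2 * Re A\<close> affine in \<open>Im L\<close>.\<close>
  define D where "D z = A z + \<i> * of_real \<delta> / of_real \<mu> * L z" for z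
  have dD: "(D has_field_derivative 0) (at z)" if z: "z \<in> \<Omega>" for z
  proof -
    have "(D has_field_derivative deriv A z + \<i> * of_real \<delta> / of_real \<mu> * (2 * r * E z / ((E z)\<^sup>2 - 1))) (at z)"
      unfolding D_def by (rule DERIV_add[OF dA(1)[OF z] DERIV_cmult[OF dL[OF z]]])
    moreover note A'_eq[OF z]
    ultimately show ?thesis by simp
  qed
  have "continuous_on \<Omega> D"
    using dD by (intro continuous_at_imp_continuous_on) (auto intro: DERIV_isCont)
  then obtain d where d: "\<And>z. z \<in> \<Omega> \<Longrightarrow> D z = d"
    using DERIV_zero_connected_constant[OF \<Omega>(2,1) finite.emptyI, of D] dD by auto
  have ReA: "2 * Re (A z) = \<delta> * \<omega> * (2 / \<mu>) * \<theta> z + 2 * Re d" if z: "z \<in> \<Omega>" for z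
  proof -
    have "\<i> * of_real \<delta> / of_real \<mu> * L z = \<i> * (of_real (\<delta> / \<mu>) * L z)" by simp
    then have "Re (\<i> * of_real \<delta> / of_real \<mu> * L z) = - (\<delta> / \<mu> * Im (L z))" by (simp only: Re_i_times) simp
    then have "Re (A z) - \<delta> / \<mu> * Im (L z) = Re d"
      using arg_cong[OF d[OF z], of Re] by (simp only: D_def plus_complex.sel)
    then show ?thesis unfolding \<theta>[OF z] by (simp add: field_simps)
  qed
  have \<rho>\<theta>: "\<rho> z = \<delta> * \<omega> * (a\<^sup>2 / \<mu>) * sin (2 * \<theta> z)" if z: "z \<in> \<Omega>" for z
    using \<rho>X[OF z] sin2L[OF z] \<omega>(1) \<theta>[OF z] by auto
  have "\<delta> * \<omega> \<in> {1, -1}" using \<delta>(1) \<omega>(1) by auto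
  moreover have "c0 \<noteq> 0" using r0 r by auto
  ultimately show ?thesis
    using cos\<theta> \<theta>_range ReA \<rho>\<theta> by (intro conjI exI[of _ c1] exI[of _ \<theta>] exI[of _ "\<delta> * \<omega>"] exI[of _ "2 * Re d"] ballI) auto
qed

section \<open>The minimal graph equation\<close>

lemma partials_of_has_derivative:
  assumes "(F has_derivative D) (at z)"
  shows "partial_x F z = D 1" "partial_y F z = D \<i>"
proof -
  have lin: "D (of_real t * v) = t * D v" for t v
    using linear_scale[OF has_derivative_linear[OF assms], of t v] by (simp add: scaleR_conv_of_real)
  have "((\<lambda>t. F (z + of_real t * v)) has_real_derivative D v) (at 0)" for v
  proof -
    have "((\<lambda>t. z + of_real t * v) has_derivative (\<lambda>t. of_real t * v)) (at 0)"
      by (auto intro!: derivative_eq_intros)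
    from diff_chain_at[OF this, of F D] assms
    have "((\<lambda>t. F (z + of_real t * v)) has_derivative (\<lambda>t. D (of_real t * v))) (at 0)"
      by (simp add: o_def)
    moreover have "(\<lambda>t. D (of_real t * v)) = (*) (D v)"
      by (rule ext) (simp only: lin mult.commute[of _ "D v"])
    ultimately show ?thesis by (simp only: has_field_derivative_def)
  qed
  from DERIV_imp_deriv[OF this[of 1]] DERIV_imp_deriv[OF this[of \<i>]]
  show "partial_x F z = D 1" "partial_y F z = D \<i>"
    by (simp_all add: partial_x_def partial_y_def mult.commute)
qed

lemma has_derivative_partials:
  assumes "F differentiable_on \<Omega>" "open \<Omega>" "z \<in> \<Omega>"
  shows "(F has_derivative (\<lambda>v. partial_x F z * Re v + partial_y F z * Im v)) (at z)"
proof -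
  obtain D where D: "(F has_derivative D) (at z)"
    using assms by (auto simp: differentiable_on_eq_differentiable_at differentiable_def)
  have "D v = partial_x F z * Re v + partial_y F z * Im v" for v
  proof -
    have "D v = D (Re v *\<^sub>R 1 + Im v *\<^sub>R \<i>)"
      by (rule arg_cong[of _ _ D]) (simp add: complex_eq_iff)
    also have "\<dots> = Re v *\<^sub>R D 1 + Im v *\<^sub>R D \<i>"
      using has_derivative_linear[OF D] by (simp only: linear_add linear_scale)
    finally show ?thesis by (simp add: partials_of_has_derivative[OF D] mult.commute)
  qed
  then have "D = (\<lambda>v. partial_x F z * Re v + partial_y F z * Im v)" by blast
  with D show ?thesis by simp
qed

text \<open>First partials are known only on \<open>\<Omega>\<close>; locality of the derivative
  carries these formulas over to second partials.\<close>

lemma partial_cong: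
  assumes "open \<Omega>" "z \<in> \<Omega>" "\<And>w. w \<in> \<Omega> \<Longrightarrow> F w = G w"
  shows "partial_x F z = partial_x G z" "partial_y F z = partial_y G z"
proof -
  have *: "eventually (\<lambda>t. F (z + v * of_real t) = G (z + v * of_real t)) (nhds 0)" for v
  proof -
    have "((\<lambda>t. z + v * of_real t) \<longlongrightarrow> z) (nhds (0::real))"
      using tendsto_compose_filtermap by (auto intro!: tendsto_eq_intros filterlim_ident)
    then have "eventually (\<lambda>t. z + v * of_real t \<in> \<Omega>) (nhds 0)"
      using assms(1,2) by (rule topological_tendstoD)
    then show ?thesis by eventually_elim (rule assms(3))
  qed
  show "partial_x F z = partial_x G z"
    unfolding partial_x_def using *[of 1] by (intro deriv_cong_ev) auto
  show "partial_y F z = partial_y G z"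
    unfolding partial_y_def using *[of \<i>] by (intro deriv_cong_ev) auto
qed

lemma partial_Re_holomorphic:
  assumes "(B has_field_derivative B') (at z)"
  shows "partial_x (\<lambda>w. 2 * Re (B w)) z = 2 * Re B'" "partial_y (\<lambda>w. 2 * Re (B w)) z = - 2 * Im B'"
proof -
  have "((\<lambda>w. 2 * Re (B w)) has_derivative (\<lambda>v. 2 * Re (B' * v))) (at z)"
    using assms by (auto simp: has_field_derivative_def intro!: derivative_eq_intros)
  from partials_of_has_derivative[OF this]
  show "partial_x (\<lambda>w. 2 * Re (B w)) z = 2 * Re B'" "partial_y (\<lambda>w. 2 * Re (B w)) z = - 2 * Im B'"
    by simp_all
qed

lemma partials_compose:
  fixes \<Omega> :: "complex set" and f :: "complex \<Rightarrow> real" and G G1 G2 :: "real \<Rightarrow> real"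
  assumes \<Omega>: "open \<Omega>" and f: "smooth_plane \<Omega> f"
    and dG: "\<And>s. s \<in> f ` \<Omega> \<Longrightarrow> (G has_real_derivative G1 s) (at s within f ` \<Omega>)"
    and dG1: "\<And>s. s \<in> f ` \<Omega> \<Longrightarrow> (G1 has_real_derivative G2 s) (at s within f ` \<Omega>)"
    and z: "z \<in> \<Omega>"
  defines "F \<equiv> \<lambda>z. G (f z)"
  shows "partial_x F z = G1 (f z) * partial_x f z" "partial_y F z = G1 (f z) * partial_y f z"
    "partial_x (partial_x F) z = G2 (f z) * (partial_x f z)\<^sup>2 + G1 (f z) * partial_x (partial_x f) z"
    "partial_y (partial_x F) z =
      G2 (f z) * partial_x f z * partial_y f z + G1 (f z) * partial_y (partial_x f) z"
    "partial_y (partial_y F) z = G2 (f z) * (partial_y f z)\<^sup>2 + G1 (f z) * partial_y (partial_y f) z"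
proof -
  have td: "times_differentiable_on (Suc (Suc 0)) \<Omega> f" using f by (simp only: smooth_plane_def)
  then have diff: "f differentiable_on \<Omega>" "partial_x f differentiable_on \<Omega>" "partial_y f differentiable_on \<Omega>"
    by simp_all
  note df = has_derivative_partials[OF diff(1) \<Omega>] and dfx = has_derivative_partials[OF diff(2) \<Omega>]
    and dfy = has_derivative_partials[OF diff(3) \<Omega>]
  have chain: "((\<lambda>z. K (f z)) has_derivative
      (\<lambda>v. (partial_x f w * Re v + partial_y f w * Im v) * K')) (at w)"
    if w: "w \<in> \<Omega>" and K: "(K has_real_derivative K') (at (f w) within f ` \<Omega>)" for K K' w
  proof -
    have "((\<lambda>z. K (f z)) has_derivative (\<lambda>v. (partial_x f w * Re v + partial_y f w * Im v) * K')) (at w within \<Omega>)"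
      using has_derivative_in_compose[OF has_derivative_at_withinI[OF df[OF w]], of K "\<lambda>x. x * K'"] K
      by (simp add: has_field_derivative_def mult_commute_abs)
    then show ?thesis using at_within_open[OF w \<Omega>] by simp
  qed
  have first: "partial_x F w = G1 (f w) * partial_x f w" "partial_y F w = G1 (f w) * partial_y f w"
    if "w \<in> \<Omega>" for w
    using partials_of_has_derivative[OF chain[OF that dG[OF imageI[OF that]]]] by (simp_all add: F_def mult.commute)
  from first[OF z] show "partial_x F z = G1 (f z) * partial_x f z" "partial_y F z = G1 (f z) * partial_y f z" .
  note c1 = chain[OF z dG1[OF imageI[OF z]]]
  have cx: "partial_x (partial_x F) z = partial_x (\<lambda>w. G1 (f w) * partial_x f w) z"
      "partial_y (partial_x F) z = partial_y (\<lambda>w. G1 (f w) * partial_x f w) z"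
    and cy: "partial_y (partial_y F) z = partial_y (\<lambda>w. G1 (f w) * partial_y f w) z"
    by (rule partial_cong[OF \<Omega> z]; erule first)+
  note px = partials_of_has_derivative[OF has_derivative_mult[OF c1 dfx[OF z]]]
    and py = partials_of_has_derivative[OF has_derivative_mult[OF c1 dfy[OF z]]]
  show "partial_x (partial_x F) z = G2 (f z) * (partial_x f z)\<^sup>2 + G1 (f z) * partial_x (partial_x f) z"
    "partial_y (partial_x F) z =
      G2 (f z) * partial_x f z * partial_y f z + G1 (f z) * partial_y (partial_x f) z"
    "partial_y (partial_y F) z = G2 (f z) * (partial_y f z)\<^sup>2 + G1 (f z) * partial_y (partial_y f) z"
    unfolding cx cy px py by (simp_all add: power2_eq_square algebra_simps)
qed

text \<open>The second partials of \<open>f\<close> are expressed through \<open>h\<close>,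
  \<open>A'\<close> and \<open>A''\<close>, because \<open>H(f)\<close> is the real part of
  \<open>2 * A\<close>. The minimal graph equation then becomes one real relation between these
  quantities.\<close>

lemma minimal_graph_harmonic_reparametrization:
  assumes f: "minimal_graph \<Omega> f" and A: "A holomorphic_on \<Omega>"
    and dH1: "\<And>s. s \<in> f ` \<Omega> \<Longrightarrow> (H1 has_real_derivative h s) (at s within f ` \<Omega>)"
    and dH: "\<And>s. s \<in> f ` \<Omega> \<Longrightarrow> (H has_real_derivative exp (- H1 s)) (at s within f ` \<Omega>)"
    and HA: "\<And>z. z \<in> \<Omega> \<Longrightarrow> H (f z) = 2 * Re (A z)"
    and z: "z \<in> \<Omega>" and grad: "(partial_x f z)\<^sup>2 + (partial_y f z)\<^sup>2 \<noteq> 0"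
  shows "deriv A z \<noteq> 0"
    "h (f z) * exp (- H1 (f z)) = 2 * Re (deriv (deriv A) z / (deriv A z)\<^sup>2) * (cmod (deriv A z))\<^sup>2"
proof -
  have \<Omega>: "open \<Omega>" and sm: "smooth_plane \<Omega> f" using f by (auto simp: minimal_graph_def)
  define e p q R S T where "e = exp (- H1 (f z))" and "p = partial_x f z" and "q = partial_y f z"
    and "R = partial_x (partial_x f) z" and "S = partial_y (partial_x f) z" and "T = partial_y (partial_y f) z"
  define hz where "hz = h (f z)"
  note defs = e_def p_def q_def R_def S_def T_def hz_def
  have "((\<lambda>s. exp (- H1 s)) has_real_derivative - h s * exp (- H1 s)) (at s within f ` \<Omega>)" if "s \<in> f ` \<Omega>" for s
    by (auto intro!: derivative_eq_intros dH1[OF that])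
  note pc = partials_compose[OF \<Omega> sm dH this z, folded defs]
  have dA: "(A has_field_derivative deriv A w) (at w)"
    "(deriv A has_field_derivative deriv (deriv A) w) (at w)" if "w \<in> \<Omega>" for w
    using that A \<Omega> by (auto intro: holomorphic_derivI holomorphic_deriv)
  have ux: "partial_x (\<lambda>z. H (f z)) w = 2 * Re (deriv A w)"
    and uy: "partial_y (\<lambda>z. H (f z)) w = 2 * Re (\<i> * deriv A w)" if w: "w \<in> \<Omega>" for w
    using partial_cong[OF \<Omega> w HA] partial_Re_holomorphic[OF dA(1)[OF w]] by simp_all
  have uxx: "partial_x (partial_x (\<lambda>z. H (f z))) z = 2 * Re (deriv (deriv A) z)"
    and uxy: "partial_y (partial_x (\<lambda>z. H (f z))) z = - 2 * Im (deriv (deriv A) z)"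
    using partial_cong[OF \<Omega> z ux] partial_Re_holomorphic[OF dA(2)[OF z]] by simp_all
  have uyy: "partial_y (partial_y (\<lambda>z. H (f z))) z = - 2 * Re (deriv (deriv A) z)"
    using partial_cong(2)[OF \<Omega> z uy] partial_Re_holomorphic(2)[OF DERIV_cmult[OF dA(2)[OF z], of \<i>]] by simp
  define x y X Y where "x = Re (deriv A z)" and "y = Im (deriv A z)"
    and "X = Re (deriv (deriv A) z)" and "Y = Im (deriv (deriv A) z)"
  have e: "e > 0" by (simp add: e_def)
  \<comment> \<open>The chain rule for \<open>u = H(f)\<close> is compared with the Cauchy-Riemann
    expressions for the first and second partials of \<open>2 * Re A\<close>.\<close>
  have eqs: "e * p = 2 * x" "e * q = - 2 * y" "- hz * e * p\<^sup>2 + e * R = 2 * X"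
    "- hz * e * p * q + e * S = - 2 * Y" "- hz * e * q\<^sup>2 + e * T = - 2 * X"
    using pc ux[OF z] uy[OF z] uxx uxy uyy by (simp_all add: x_def y_def X_def Y_def)
  have mg: "(1 + q\<^sup>2) * R - 2 * S * p * q + (1 + p\<^sup>2) * T = 0"
    using f z by (simp add: minimal_graph_def defs)
  have "x\<^sup>2 + y\<^sup>2 \<noteq> 0"
  proof
    assume "x\<^sup>2 + y\<^sup>2 = 0"
    then have "e * p = 0" "e * q = 0" using eqs by (auto simp: sum_power2_eq_zero_iff)
    then show False using grad e by (simp add: defs)
  qed
  then show A'0: "deriv A z \<noteq> 0" by (auto simp: x_def y_def)
  \<comment> \<open>the \<open>h\<close>-terms of \<open>q\<^sup>2 R - 2 p q S + p\<^sup>2 T\<close> cancel, and \<open>R + T = h (p\<^sup>2 + q\<^sup>2)\<close>\<close>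
  have "e * (hz * e * (x\<^sup>2 + y\<^sup>2)) = e * (2 * (X * (x\<^sup>2 - y\<^sup>2) + 2 * Y * x * y))"
    using eqs mg by algebra
  then have 1: "hz * e * (x\<^sup>2 + y\<^sup>2) = 2 * (X * (x\<^sup>2 - y\<^sup>2) + 2 * Y * x * y)"
    using e by (simp only: mult_cancel_left) simp
  have n: "(cmod (deriv A z))\<^sup>2 = x\<^sup>2 + y\<^sup>2" by (simp add: cmod_power2 x_def y_def)
  have "Re (deriv (deriv A) z / (deriv A z)\<^sup>2) = (X * (x\<^sup>2 - y\<^sup>2) + 2 * Y * x * y) / (x\<^sup>2 + y\<^sup>2)\<^sup>2"
  proof -
    have "deriv (deriv A) z / (deriv A z)\<^sup>2 = deriv (deriv A) z * (cnj (deriv A z))\<^sup>2 / of_real ((x\<^sup>2 + y\<^sup>2)\<^sup>2)"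
      using A'0 unfolding n[symmetric] of_real_power[of "(cmod (deriv A z))\<^sup>2"] complex_norm_square
      by (simp add: power_mult_distrib)
    moreover have "Re (deriv (deriv A) z * (cnj (deriv A z))\<^sup>2) = X * (x\<^sup>2 - y\<^sup>2) + 2 * Y * x * y"
      by (simp add: x_def y_def X_def Y_def power2_eq_square algebra_simps)
    ultimately show ?thesis by (simp only: Re_divide_of_real)
  qed
  moreover have "u = 2 * (v / N\<^sup>2) * N" if "N \<noteq> 0" "u * N = 2 * v" for u v N :: real
    using that by (simp add: power2_eq_square nonzero_eq_divide_eq)
  note this[OF \<open>x\<^sup>2 + y\<^sup>2 \<noteq> 0\<close> 1]
  ultimately show "h (f z) * exp (- H1 (f z)) = 2 * Re (deriv (deriv A) z / (deriv A z)\<^sup>2) * (cmod (deriv A z))\<^sup>2"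
    by (simp only: n hz_def e_def)
qed

section \<open>The classification\<close>

theorem mainTheorem7:
  fixes \<Omega> :: "complex set" and f :: "complex \<Rightarrow> real"
    and U :: "real set" and g :: "real \<Rightarrow> real"
    and A :: "complex \<Rightarrow> complex" and k :: real and c0 r :: complex
  defines "a \<equiv> sqrt (cmod c0)"
  assumes "admissible_pair \<Omega> f U g"
    and "associated_function \<Omega> f g A"
    and "associated_constants \<Omega> A k c0"
    and "k < 0"
    and "r\<^sup>2 = c0"
  shows "c0 \<noteq> 0 \<and>
    (\<exists>(c1::complex) (C2::real) (C3::real).
      (\<forall>z\<in>\<Omega>. cmod (wall_arg r c1 z) = 1) \<and>
      (
       \<comment> \<open>Great Wall\<close>
       ((\<exists>\<sigma>\<in>{1, -1}. great_wall \<Omega> r c1 a \<sigma> (- C2) f) \<and>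
        (\<forall>s\<in>f ` \<Omega>. first_char g s = a * tanh (a * (s + C2))) \<and>
        (let P = (\<lambda>s. sech (a * (s + C2))) in
          \<exists>\<Gamma>\<in>{0<..<1}. \<exists>\<tau>\<in>{1, -1}.
            cn_form (f ` \<Omega>) P a \<Gamma> \<tau> C3 g \<and> sharp_wall \<Omega> r c1 a \<Gamma> \<tau> C3 (g \<circ> f) \<or>
            dn_form (f ` \<Omega>) P a \<Gamma> \<tau> C3 g \<and> thick_wall \<Omega> r c1 a \<Gamma> \<tau> C3 (g \<circ> f)))
       \<or>
       \<comment> \<open>Thick Wall\<close>
       (\<exists>\<gamma>\<in>{0<..<1}.
        (\<exists>\<sigma>\<in>{1, -1}. thick_wall \<Omega> r c1 a \<gamma> \<sigma> (- C2) f) \<and>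
        (\<forall>s\<in>f ` \<Omega>. first_char g s = a * jacobi_sc (a * (s + C2)) \<gamma> * jacobi_dn (a * (s + C2)) \<gamma>) \<and>
        (let P = (\<lambda>s. jacobi_dn (a * (s + C2)) \<gamma>) in
          \<exists>\<Gamma>\<in>{0<..<1}. \<exists>\<tau>\<in>{1, -1}.
            sech_form (f ` \<Omega>) P a \<tau> C3 g \<and> great_wall \<Omega> r c1 a \<tau> C3 (g \<circ> f) \<or>
            cn_form (f ` \<Omega>) P a \<Gamma> \<tau> C3 g \<and> sharp_wall \<Omega> r c1 a \<Gamma> \<tau> C3 (g \<circ> f) \<or>
            dn_form (f ` \<Omega>) P a \<Gamma> \<tau> C3 g \<and> thick_wall \<Omega> r c1 a \<Gamma> \<tau> C3 (g \<circ> f)))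
       \<or>
       \<comment> \<open>Sharp Wall\<close>
       (\<exists>\<gamma>\<in>{0<..<1}.
        (\<exists>\<sigma>\<in>{1, -1}. sharp_wall \<Omega> r c1 a \<gamma> \<sigma> (- C2) f) \<and>
        (\<forall>s\<in>f ` \<Omega>. first_char g s =
            \<gamma> * a * jacobi_sd (a / \<gamma> * (s + C2)) \<gamma> * jacobi_cn (a / \<gamma> * (s + C2)) \<gamma>) \<and>
        (let P = (\<lambda>s. jacobi_cn (a / \<gamma> * (s + C2)) \<gamma>) in
          \<exists>\<Gamma>\<in>{0<..<1}. \<exists>\<tau>\<in>{1, -1}.
            sech_form (f ` \<Omega>) P a \<tau> C3 g \<and> great_wall \<Omega> r c1 a \<tau> C3 (g \<circ> f) \<or>
            cn_form (f ` \<Omega>) P a \<Gamma> \<tau> C3 g \<and> sharp_wall \<Omega> r c1 a \<Gamma> \<tau> C3 (g \<circ> f) \<or>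
            dn_form (f ` \<Omega>) P a \<Gamma> \<tau> C3 g \<and> thick_wall \<Omega> r c1 a \<Gamma> \<tau> C3 (g \<circ> f)))
      ))"
proof -
  have mg: "minimal_graph \<Omega> f" and mgt: "minimal_graph_transformation \<Omega> f U g"
    and grad: "\<And>z. z \<in> \<Omega> \<Longrightarrow> (partial_x f z)\<^sup>2 + (partial_y f z)\<^sup>2 \<noteq> 0"
    and g'0: "\<And>s. s \<in> U \<Longrightarrow> deriv g s ^ 3 - deriv g s \<noteq> 0"
    and h0: "\<And>s. s \<in> f ` \<Omega> \<Longrightarrow> first_char g s \<noteq> 0"
    using assms(2) by (auto simp: admissible_pair_def)
  have \<Omega>: "open \<Omega>" "connected \<Omega>" "\<Omega> \<noteq> {}" and smf: "smooth_plane \<Omega> f"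
    using mg by (auto simp: minimal_graph_def)
  have U: "open U" and smg: "smooth_line U g" and fU: "f ` \<Omega> \<subseteq> U"
    using mgt by (auto simp: minimal_graph_transformation_def)
  have A: "A holomorphic_on \<Omega>" using assms(3) by (simp add: associated_function_def)
  obtain H1 H where H1H: "\<forall>s\<in>f ` \<Omega>. (H1 has_real_derivative first_char g s) (at s within f ` \<Omega>)"
      "\<forall>s\<in>f ` \<Omega>. (H has_real_derivative exp (- H1 s)) (at s within f ` \<Omega>)"
      "\<forall>z\<in>\<Omega>. complex_of_real (H (f z)) = A z + cnj (A z)"
    using assms(3) unfolding associated_function_def by (elim conjE exE)
  note dH1 = H1H(1)[rule_format] and dH = H1H(2)[rule_format] and HAc = H1H(3)[rule_format]
  have HA: "H (f z) = 2 * Re (A z)" if "z \<in> \<Omega>" for z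
    using arg_cong[OF HAc[OF that], of Re] by simp
  define h where "h = first_char g"
  define \<mu> where "\<mu> = sqrt (- k)"
  have \<mu>: "\<mu> > 0" using assms(5) by (simp add: \<mu>_def)
  have A'0: "deriv A z \<noteq> 0"
    and h\<rho>: "h (f z) * exp (- H1 (f z)) =
      2 * Re (deriv (deriv A) z / (deriv A z)\<^sup>2) * (cmod (deriv A z))\<^sup>2" if "z \<in> \<Omega>" for z
    unfolding h_def
    by (rule minimal_graph_harmonic_reparametrization[OF mg A dH1 dH HA that grad[OF that]]; assumption)+
  have \<rho>: "2 * Re (deriv (deriv A) z / (deriv A z)\<^sup>2) * (cmod (deriv A z))\<^sup>2 \<noteq> 0" if "z \<in> \<Omega>" for z
    using h0[OF imageI[OF that]] by (simp only: h\<rho>[OF that, symmetric] h_def) simp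
  from wall_angle[OF \<Omega> A A'0 assms(4,5,6) \<rho>, folded a_def \<mu>_def]
  obtain c1 \<theta> \<eta> C where c0: "c0 \<noteq> 0" and \<eta>: "\<eta> \<in> {1, -1::real}"
    and X1: "\<And>z. z \<in> \<Omega> \<Longrightarrow> cmod (wall_arg r c1 z) = 1"
    and W: "\<And>z. z \<in> \<Omega> \<Longrightarrow> wall r c1 z = cos (\<theta> z)"
    and \<theta>: "\<And>z. z \<in> \<Omega> \<Longrightarrow> 0 < \<theta> z \<and> \<theta> z < pi / 2"
    and ReA: "\<And>z. z \<in> \<Omega> \<Longrightarrow> 2 * Re (A z) = \<eta> * (2 / \<mu>) * \<theta> z + C"
    and h\<theta>: "\<And>z. z \<in> \<Omega> \<Longrightarrow> 2 * Re (deriv (deriv A) z / (deriv A z)\<^sup>2) * (cmod (deriv A z))\<^sup>2 =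
      \<eta> * (a\<^sup>2 / \<mu>) * sin (2 * \<theta> z)"
    by blast
  have a: "a > 0" using c0 by (simp add: a_def)
  define I where "I = f ` \<Omega>"
  \<comment> \<open>This inverts the affine relation between \<open>H(f)\<close> and
    \<open>\<theta>\<close>, so that \<open>\<phi>(f) = \<theta>\<close>; the inverse of the sign
    \<open>\<eta>\<close> is \<open>\<eta>\<close>. Its derivative is \<open>\<psi>\<close>.\<close>
  define \<phi> where "\<phi> s = \<eta> * (\<mu> / 2) * (H s - C)" for s
  define \<psi> where "\<psi> s = \<eta> * (\<mu> / 2) * exp (- H1 s)" for s
  have \<phi>f: "\<phi> (f z) = \<theta> z" if "z \<in> \<Omega>" for z
    using ReA[OF that] \<eta> \<mu> by (auto simp: \<phi>_def HA[OF that])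
  \<comment> \<open>The image is an interval, so functions with zero derivative within it are
    constant.\<close>
  have "continuous_on \<Omega> f"
    using smf by (metis smooth_plane_def times_differentiable_on.simps(1))
  then have "connected I" unfolding I_def using \<Omega>(2) by (rule connected_continuous_image)
  then have I: "convex I" "I \<noteq> {}"
    using \<Omega>(3) by (auto simp: I_def simp flip: is_interval_convex_1 is_interval_connected_1)
  have \<phi>: "0 < \<phi> s \<and> \<phi> s < pi / 2" if "s \<in> I" for s
    using that \<theta> \<phi>f by (auto simp: I_def)
  have d\<phi>: "(\<phi> has_real_derivative \<psi> s) (at s within I)" if "s \<in> I" for s
    unfolding \<phi>_def \<psi>_def using that dH by (auto simp: I_def intro!: derivative_eq_intros)
  have d\<psi>: "(\<psi> has_real_derivative - h s * \<psi> s) (at s within I)" if "s \<in> I" for s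
    unfolding \<psi>_def h_def using that dH1 by (auto simp: I_def intro!: derivative_eq_intros)
  \<comment> \<open>The minimal graph equation of \<open>f\<close> becomes the pendulum equation,
    since \<open>\<phi>'' = - h * \<psi>\<close>.\<close>
  have h\<psi>: "h s * \<psi> s = a\<^sup>2 * sin (\<phi> s) * cos (\<phi> s)" if s: "s \<in> I" for s
  proof -
    obtain z where z: "z \<in> \<Omega>" "s = f z" using s by (auto simp: I_def)
    have "h s * exp (- H1 s) = \<eta> * (a\<^sup>2 / \<mu>) * (2 * sin (\<phi> s) * cos (\<phi> s))"
      using h\<rho>[OF z(1)] h\<theta>[OF z(1)] by (simp add: z \<phi>f sin_double)
    then have "\<eta> * (\<mu> / 2) * (h s * exp (- H1 s)) =
        \<eta> * (\<mu> / 2) * (\<eta> * (a\<^sup>2 / \<mu>) * (2 * sin (\<phi> s) * cos (\<phi> s)))" by simp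
    then show ?thesis using \<eta> \<mu> by (auto simp: \<psi>_def mult_ac)
  qed
  have \<psi>0: "\<psi> s \<noteq> 0" for s using \<eta> \<mu> by (auto simp: \<psi>_def)
  have "(deriv ^^ 0) g differentiable_on U" "(deriv ^^ 1) g differentiable_on U"
    using smg unfolding smooth_line_def by blast+
  then have gdiff: "g differentiable_on U" "deriv g differentiable_on U" by simp_all
  have dg: "(g has_real_derivative deriv g s) (at s within I)"
    "(deriv g has_real_derivative deriv (deriv g) s) (at s within I)" if "s \<in> I" for s
  proof -
    have "s \<in> U" using that fU by (auto simp: I_def)
    then have "g differentiable at s" "deriv g differentiable at s"
      using gdiff U by (simp_all add: differentiable_on_eq_differentiable_at)
    then show "(g has_real_derivative deriv g s) (at s within I)"
      "(deriv g has_real_derivative deriv (deriv g) s) (at s within I)"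
      by (simp_all add: DERIV_deriv_iff_real_differentiable has_field_derivative_at_within)
  qed
  have gI: "deriv g s ^ 3 - deriv g s \<noteq> 0" if "s \<in> I" for s
    using that fU g'0 by (auto simp: I_def)
  have g0: "deriv g s \<noteq> 0" if "s \<in> I" for s
    using gI[OF that] by auto
  have dg': "(deriv g has_real_derivative h s * (deriv g s ^ 3 - deriv g s)) (at s within I)" if "s \<in> I" for s
    using dg(2)[OF that] gI[OF that] by (simp add: h_def first_char_def)
  \<comment> \<open>One angle, two clocks: \<open>E\<close> is the energy with time
    \<open>s\<close>, \<open>E'\<close> with time \<open>g(s)\<close>.\<close>
  have "\<exists>E E'. E \<noteq> E' \<and> (\<forall>s\<in>I. (\<psi> s)\<^sup>2 = E - a\<^sup>2 * (sin (\<phi> s))\<^sup>2) \<and>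
      (\<forall>s\<in>I. (\<psi> s / deriv g s)\<^sup>2 = E' - a\<^sup>2 * (sin (\<phi> s))\<^sup>2)"
    by (rule pendulum_pair[OF I d\<phi> d\<psi> h\<psi> \<psi>0 dg' gI]; assumption)
  then obtain E E' where EE: "E \<noteq> E'"
    and EB: "\<forall>s\<in>I. (\<psi> s)\<^sup>2 = E - a\<^sup>2 * (sin (\<phi> s))\<^sup>2"
      "\<forall>s\<in>I. (\<psi> s / deriv g s)\<^sup>2 = E' - a\<^sup>2 * (sin (\<phi> s))\<^sup>2"
    by (elim exE conjE)
  note E = EB(1)[rule_format] and E' = EB(2)[rule_format]
  obtain \<omega> where \<omega>: "\<omega> \<in> {1, -1::real}" "\<And>s. s \<in> I \<Longrightarrow> deriv g s = \<omega> * \<bar>deriv g s\<bar>"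
    using connected_nonzero_constant_sign[OF \<open>connected I\<close>, of "deriv g"] dg(2) g0
    by (metis DERIV_continuous continuous_on_eq_continuous_within)
  \<comment> \<open>The velocity of the angle in the time \<open>g(s)\<close> is
    \<open>\<psi> / g'\<close>, with sign \<open>\<eta>\<close> times the sign of
    \<open>g'\<close>.\<close>
  define \<tau> where "\<tau> = \<eta> * \<omega>"
  have \<tau>: "\<tau> \<in> {1, -1}" using \<eta> \<omega>(1) by (auto simp: \<tau>_def)
  have pos: "E - a\<^sup>2 * (sin (\<phi> s))\<^sup>2 > 0" "E' - a\<^sup>2 * (sin (\<phi> s))\<^sup>2 > 0" if "s \<in> I" for s
    using \<psi>0 g0[OF that] by (simp_all flip: E[OF that] E'[OF that])
  have abs\<psi>: "\<psi> s = \<eta> * \<bar>\<psi> s\<bar>" for s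
    using \<eta> \<mu> by (auto simp: \<psi>_def abs_mult)
  have \<psi>E: "\<psi> s = \<eta> * sqrt (E - a\<^sup>2 * (sin (\<phi> s))\<^sup>2)" if "s \<in> I" for s
    using abs\<psi>[of s] by (simp flip: E[OF that])
  have \<psi>E': "\<psi> s = \<tau> * deriv g s * sqrt (E' - a\<^sup>2 * (sin (\<phi> s))\<^sup>2)" if s: "s \<in> I" for s
  proof -
    have "sqrt (E' - a\<^sup>2 * (sin (\<phi> s))\<^sup>2) = \<bar>\<psi> s\<bar> / \<bar>deriv g s\<bar>"
      by (simp flip: E'[OF s])
    moreover have "\<omega> * deriv g s = \<bar>deriv g s\<bar>"
      using \<omega>(1) \<omega>(2)[OF s] by auto
    ultimately have "\<tau> * deriv g s * sqrt (E' - a\<^sup>2 * (sin (\<phi> s))\<^sup>2) = \<eta> * \<bar>deriv g s\<bar> * (\<bar>\<psi> s\<bar> / \<bar>deriv g s\<bar>)"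
      by (simp add: \<tau>_def mult.assoc)
    also have "\<dots> = \<psi> s" using abs\<psi>[of s] g0[OF s] by simp
    finally show ?thesis by simp
  qed
  let ?w = "\<lambda>s. cos (\<phi> s)"
  have d\<phi>E: "(\<phi> has_real_derivative \<eta> * 1 * sqrt (E - a\<^sup>2 * (sin (\<phi> s))\<^sup>2)) (at s within I)"
    and d\<phi>E': "(\<phi> has_real_derivative \<tau> * deriv g s * sqrt (E' - a\<^sup>2 * (sin (\<phi> s))\<^sup>2)) (at s within I)"
    if "s \<in> I" for s
    using d\<phi>[OF that] \<psi>E[OF that] \<psi>E'[OF that] by simp_all
  \<comment> \<open>Time is the identity here: the law expresses \<open>s\<close> through the angle,
    which at \<open>s = f z\<close> is the formula for \<open>f\<close>.\<close>
  have "\<exists>C. E = a\<^sup>2 \<and> sech_form I ?w a \<eta> C (\<lambda>s. s) \<or>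
      (\<exists>\<Gamma>\<in>{0<..<1}. E = (a / \<Gamma>)\<^sup>2 \<and> cn_form I ?w a \<Gamma> \<eta> C (\<lambda>s. s)) \<or>
      (\<exists>\<Gamma>\<in>{0<..<1}. E = (a * \<Gamma>)\<^sup>2 \<and> dn_form I ?w a \<Gamma> \<eta> C (\<lambda>s. s))"
    by (rule pendulum_forms[OF I a \<eta> \<phi> pos(1) d\<phi>E DERIV_ident]; assumption)
  then obtain C\<^sub>f where f_forms: "E = a\<^sup>2 \<and> sech_form I ?w a \<eta> C\<^sub>f (\<lambda>s. s) \<or>
      (\<exists>\<Gamma>\<in>{0<..<1}. E = (a / \<Gamma>)\<^sup>2 \<and> cn_form I ?w a \<Gamma> \<eta> C\<^sub>f (\<lambda>s. s)) \<or>
      (\<exists>\<Gamma>\<in>{0<..<1}. E = (a * \<Gamma>)\<^sup>2 \<and> dn_form I ?w a \<Gamma> \<eta> C\<^sub>f (\<lambda>s. s))" ..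
  \<comment> \<open>The same angle is read on the clock \<open>g\<close>, with energy
    \<open>E'\<close>.\<close>
  have "\<exists>C. E' = a\<^sup>2 \<and> sech_form I ?w a \<tau> C g \<or>
      (\<exists>\<Gamma>\<in>{0<..<1}. E' = (a / \<Gamma>)\<^sup>2 \<and> cn_form I ?w a \<Gamma> \<tau> C g) \<or>
      (\<exists>\<Gamma>\<in>{0<..<1}. E' = (a * \<Gamma>)\<^sup>2 \<and> dn_form I ?w a \<Gamma> \<tau> C g)"
    by (rule pendulum_forms[OF I a \<tau> \<phi> pos(2) d\<phi>E' dg(1)]; assumption)
  then obtain C3 where g_forms: "E' = a\<^sup>2 \<and> sech_form I ?w a \<tau> C3 g \<or>
      (\<exists>\<Gamma>\<in>{0<..<1}. E' = (a / \<Gamma>)\<^sup>2 \<and> cn_form I ?w a \<Gamma> \<tau> C3 g) \<or>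
      (\<exists>\<Gamma>\<in>{0<..<1}. E' = (a * \<Gamma>)\<^sup>2 \<and> dn_form I ?w a \<Gamma> \<tau> C3 g)" ..
  \<comment> \<open>Along \<open>f\<close> the cosine of the angle is the wall function, so forms on
    the line pull back to wall surfaces.\<close>
  have surface: "sech_form I ?w a \<sigma> K F \<Longrightarrow> great_wall \<Omega> r c1 a \<sigma> K (F \<circ> f)"
    "cn_form I ?w a \<Gamma> \<sigma> K F \<Longrightarrow> sharp_wall \<Omega> r c1 a \<Gamma> \<sigma> K (F \<circ> f)"
    "dn_form I ?w a \<Gamma> \<sigma> K F \<Longrightarrow> thick_wall \<Omega> r c1 a \<Gamma> \<sigma> K (F \<circ> f)" for \<sigma> \<Gamma> K F
    by (auto simp: great_wall_def sharp_wall_def thick_wall_def sech_form_def cn_form_def dn_form_def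
        I_def \<phi>f W)
  have surface_f: "sech_form I ?w a \<eta> K (\<lambda>s. s) \<Longrightarrow> great_wall \<Omega> r c1 a \<eta> K f"
    "cn_form I ?w a \<Gamma> \<eta> K (\<lambda>s. s) \<Longrightarrow> sharp_wall \<Omega> r c1 a \<Gamma> \<eta> K f"
    "dn_form I ?w a \<Gamma> \<eta> K (\<lambda>s. s) \<Longrightarrow> thick_wall \<Omega> r c1 a \<Gamma> \<eta> K f" for \<Gamma> K
    by (rule surface[where F = "\<lambda>s. s", unfolded o_def]; assumption)+
  \<comment> \<open>The alternatives keep track of whether \<open>E'\<close> equals
    \<open>a\<^sup>2\<close>, which is what excludes the sech form of \<open>g\<close> when
    \<open>f\<close> is a Great Wall.\<close>
  have g_cases: "\<exists>\<Gamma>\<in>{0<..<1}. \<exists>\<tau>\<in>{1, -1}.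
      E' = a\<^sup>2 \<and> sech_form I P a \<tau> C3 g \<and> great_wall \<Omega> r c1 a \<tau> C3 (g \<circ> f) \<or>
      E' \<noteq> a\<^sup>2 \<and> cn_form I P a \<Gamma> \<tau> C3 g \<and> sharp_wall \<Omega> r c1 a \<Gamma> \<tau> C3 (g \<circ> f) \<or>
      E' \<noteq> a\<^sup>2 \<and> dn_form I P a \<Gamma> \<tau> C3 g \<and> thick_wall \<Omega> r c1 a \<Gamma> \<tau> C3 (g \<circ> f)"
    if P: "\<And>s. s \<in> I \<Longrightarrow> P s = ?w s" for P
  proof -
    have P_forms: "sech_form I ?w a \<tau> C3 g \<Longrightarrow> sech_form I P a \<tau> C3 g"
      "cn_form I ?w a \<Gamma> \<tau> C3 g \<Longrightarrow> cn_form I P a \<Gamma> \<tau> C3 g"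
      "dn_form I ?w a \<Gamma> \<tau> C3 g \<Longrightarrow> dn_form I P a \<Gamma> \<tau> C3 g" for \<Gamma>
      using P by (simp_all add: sech_form_def cn_form_def dn_form_def)
    \<comment> \<open>The sech form involves no modulus; \<open>1/2\<close> serves as the witness
      for \<open>\<Gamma>\<close> in that alternative.\<close>
    have half: "(1/2::real) \<in> {0<..<1}" by simp
    have sq: "(a / \<Gamma>)\<^sup>2 \<noteq> a\<^sup>2" "(a * \<Gamma>)\<^sup>2 \<noteq> a\<^sup>2" if "\<Gamma> \<in> {0<..<1}" for \<Gamma>
    proof -
      have "\<Gamma>\<^sup>2 < 1" "\<Gamma>\<^sup>2 > 0" using that by (simp_all add: power_less_one_iff)
      then show "(a / \<Gamma>)\<^sup>2 \<noteq> a\<^sup>2" "(a * \<Gamma>)\<^sup>2 \<noteq> a\<^sup>2"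
        using a by (auto simp: power_divide power_mult_distrib field_simps)
    qed
    from g_forms show ?thesis
    proof (elim disjE conjE bexE)
      assume "E' = a\<^sup>2" "sech_form I ?w a \<tau> C3 g"
      then show ?thesis using \<tau> half surface(1) P_forms(1) by blast
    next
      fix \<Gamma> assume \<Gamma>: "\<Gamma> \<in> {0<..<1}" and "E' = (a / \<Gamma>)\<^sup>2" "cn_form I ?w a \<Gamma> \<tau> C3 g"
      then show ?thesis using \<tau> sq(1)[OF \<Gamma>] surface(2) P_forms(2) by blast
    next
      fix \<Gamma> assume \<Gamma>: "\<Gamma> \<in> {0<..<1}" and "E' = (a * \<Gamma>)\<^sup>2" "dn_form I ?w a \<Gamma> \<tau> C3 g"
      then show ?thesis using \<tau> sq(2)[OF \<Gamma>] surface(3) P_forms(3) by blast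
    qed
  qed
  define C2 where "C2 = - C\<^sub>f"
  have h_eq: "h s * (\<eta> * sqrt (E - a\<^sup>2 * (sin (\<phi> s))\<^sup>2)) = a\<^sup>2 * sin (\<phi> s) * cos (\<phi> s)" if "s \<in> I" for s
    using h\<psi>[OF that] \<psi>E[OF that] by simp
  have X1': "\<forall>z\<in>\<Omega>. cmod (wall_arg r c1 z) = 1" using X1 by blast
  from f_forms show ?thesis
  proof (elim disjE conjE bexE)
    \<comment> \<open>Great Wall: here \<open>E = a\<^sup>2\<close>, so \<open>E'\<close> differs
      from \<open>a\<^sup>2\<close> and \<open>g\<close> has the cn or dn form.\<close>
    assume Ea: "E = a\<^sup>2" and F: "sech_form I ?w a \<eta> C\<^sub>f (\<lambda>s. s)"
    have s: "s = \<eta> / a * arsech (cos (\<phi> s)) - C2" if "s \<in> I" for s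
      using F that by (simp add: sech_form_def C2_def)
    have P: "sech (a * (s + C2)) = ?w s" and hs: "h s = a * tanh (a * (s + C2))" if "s \<in> I" for s
      using pendulum_sech[OF _ _ a \<eta> s[OF that], of "h s"] \<phi>[OF that] h_eq[OF that] Ea by auto
    have walls: "\<exists>\<sigma>\<in>{1, -1}. great_wall \<Omega> r c1 a \<sigma> (- C2) f"
      using surface_f(1)[OF F] \<eta> by (auto simp: C2_def)
    have hs': "\<forall>s\<in>I. h s = a * tanh (a * (s + C2))" using hs by blast
    have gs: "\<exists>\<Gamma>\<in>{0<..<1}. \<exists>\<tau>\<in>{1, -1}.
        cn_form I (\<lambda>s. sech (a * (s + C2))) a \<Gamma> \<tau> C3 g \<and> sharp_wall \<Omega> r c1 a \<Gamma> \<tau> C3 (g \<circ> f) \<or>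
        dn_form I (\<lambda>s. sech (a * (s + C2))) a \<Gamma> \<tau> C3 g \<and> thick_wall \<Omega> r c1 a \<Gamma> \<tau> C3 (g \<circ> f)"
      using g_cases[of "\<lambda>s. sech (a * (s + C2))"] P EE Ea by blast
    show ?thesis
      unfolding I_def[symmetric] h_def[symmetric] Let_def
      by (rule conjI[OF c0], rule exI[of _ c1], rule exI[of _ C2], rule exI[of _ C3], rule conjI[OF X1'],
          rule disjI1, intro conjI) (rule walls hs' gs)+
  next
    \<comment> \<open>Thick Wall: the energy \<open>E\<close> lies below \<open>a\<^sup>2\<close>,
      and the three forms of \<open>g\<close> remain possible.\<close>
    fix \<gamma> assume \<gamma>: "\<gamma> \<in> {0<..<1}" and Ea: "E = (a * \<gamma>)\<^sup>2" and F: "dn_form I ?w a \<gamma> \<eta> C\<^sub>f (\<lambda>s. s)"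
    have s: "s = \<eta> / a * arcdn (cos (\<phi> s)) \<gamma> - C2" if "s \<in> I" for s
      using F that by (simp add: dn_form_def C2_def)
    have P: "jacobi_dn (a * (s + C2)) \<gamma> = ?w s"
      and hs: "h s = a * jacobi_sc (a * (s + C2)) \<gamma> * jacobi_dn (a * (s + C2)) \<gamma>" if "s \<in> I" for s
      using pendulum_dn[OF _ _ a \<eta> \<gamma> _ s[OF that], of "h s"] \<phi>[OF that] h_eq[OF that] pos(1)[OF that] Ea
      by auto
    have walls: "\<exists>\<sigma>\<in>{1, -1}. thick_wall \<Omega> r c1 a \<gamma> \<sigma> (- C2) f"
      using surface_f(3)[OF F] \<eta> by (auto simp: C2_def)
    have hs': "\<forall>s\<in>I. h s = a * jacobi_sc (a * (s + C2)) \<gamma> * jacobi_dn (a * (s + C2)) \<gamma>" using hs by blast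
    have gs: "\<exists>\<Gamma>\<in>{0<..<1}. \<exists>\<tau>\<in>{1, -1}.
        sech_form I (\<lambda>s. jacobi_dn (a * (s + C2)) \<gamma>) a \<tau> C3 g \<and> great_wall \<Omega> r c1 a \<tau> C3 (g \<circ> f) \<or>
        cn_form I (\<lambda>s. jacobi_dn (a * (s + C2)) \<gamma>) a \<Gamma> \<tau> C3 g \<and> sharp_wall \<Omega> r c1 a \<Gamma> \<tau> C3 (g \<circ> f) \<or>
        dn_form I (\<lambda>s. jacobi_dn (a * (s + C2)) \<gamma>) a \<Gamma> \<tau> C3 g \<and> thick_wall \<Omega> r c1 a \<Gamma> \<tau> C3 (g \<circ> f)"
      using g_cases[of "\<lambda>s. jacobi_dn (a * (s + C2)) \<gamma>"] P EE Ea by blast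
    show ?thesis
      unfolding I_def[symmetric] h_def[symmetric] Let_def
      by (rule conjI[OF c0], rule exI[of _ c1], rule exI[of _ C2], rule exI[of _ C3], rule conjI[OF X1'],
          rule disjI2, rule disjI1, rule bexI[OF _ \<gamma>], intro conjI) (rule walls hs' gs)+
  next
    \<comment> \<open>Sharp Wall: the energy \<open>E\<close> lies above \<open>a\<^sup>2\<close>,
      and the natural scale of time is \<open>a / \<gamma> = sqrt E\<close>.\<close>
    fix \<gamma> assume \<gamma>: "\<gamma> \<in> {0<..<1}" and Ea: "E = (a / \<gamma>)\<^sup>2" and F: "cn_form I ?w a \<gamma> \<eta> C\<^sub>f (\<lambda>s. s)"
    have s: "s = \<eta> * \<gamma> / a * arccn (cos (\<phi> s)) \<gamma> - C2" if "s \<in> I" for s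
      using F that by (simp add: cn_form_def C2_def)
    have P: "jacobi_cn (a / \<gamma> * (s + C2)) \<gamma> = ?w s"
      and hs: "h s = \<gamma> * a * jacobi_sd (a / \<gamma> * (s + C2)) \<gamma> * jacobi_cn (a / \<gamma> * (s + C2)) \<gamma>"
      if "s \<in> I" for s
      using pendulum_cn[OF _ _ a \<eta> \<gamma> s[OF that], of "h s"] \<phi>[OF that] h_eq[OF that] Ea by auto
    have walls: "\<exists>\<sigma>\<in>{1, -1}. sharp_wall \<Omega> r c1 a \<gamma> \<sigma> (- C2) f"
      using surface_f(2)[OF F] \<eta> by (auto simp: C2_def)
    have hs': "\<forall>s\<in>I. h s = \<gamma> * a * jacobi_sd (a / \<gamma> * (s + C2)) \<gamma> * jacobi_cn (a / \<gamma> * (s + C2)) \<gamma>" using hs by blast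
    have gs: "\<exists>\<Gamma>\<in>{0<..<1}. \<exists>\<tau>\<in>{1, -1}.
        sech_form I (\<lambda>s. jacobi_cn (a / \<gamma> * (s + C2)) \<gamma>) a \<tau> C3 g \<and> great_wall \<Omega> r c1 a \<tau> C3 (g \<circ> f) \<or>
        cn_form I (\<lambda>s. jacobi_cn (a / \<gamma> * (s + C2)) \<gamma>) a \<Gamma> \<tau> C3 g \<and> sharp_wall \<Omega> r c1 a \<Gamma> \<tau> C3 (g \<circ> f) \<or>
        dn_form I (\<lambda>s. jacobi_cn (a / \<gamma> * (s + C2)) \<gamma>) a \<Gamma> \<tau> C3 g \<and> thick_wall \<Omega> r c1 a \<Gamma> \<tau> C3 (g \<circ> f)"
      using g_cases[of "\<lambda>s. jacobi_cn (a / \<gamma> * (s + C2)) \<gamma>"] P EE Ea by blast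
    show ?thesis
      unfolding I_def[symmetric] h_def[symmetric] Let_def
      by (rule conjI[OF c0], rule exI[of _ c1], rule exI[of _ C2], rule exI[of _ C3], rule conjI[OF X1'],
          rule disjI2, rule disjI2, rule bexI[OF _ \<gamma>], intro conjI) (rule walls hs' gs)+
  qed
qed

end
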